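(* Let $(Y_{N,k})_{N\in\mathbb{N},\,k\in\{1,\dots,N\}}$ be a triangular array of real-valued square-integrable random variables such that for every $N$ the family $(Y_{N,k})_{k\in\{1,\dots,N\}}$ has a dependency graph of maximal degree $D(N)$. Fix a real-valued family $(c_{N,k})_{N\in\mathbb{N},\,k\in\{1,\dots,N\}}$. Define $S_N=\sum_{k=1}^N Y_{N,k}$, $v_N=\sqrt{\operatorname{Var}[S_N]}$, $W_N=(S_N-\mathbb{E}[S_N])/v_N$, and for $\delta\in(2,\infty)$ (when $Y_{N,k}\in L^\delta$ for all $N,k$), $\mathcal{A}_\delta(N)=\sum_{k=1}^N\mathbb{E}[|Y_{N,k}-c_{N,k}|^\delta]$ and $$\xi_\delta(N)=\left(\frac{N}{\mathcal{A}_\delta(N)}\right)^{\frac1\delta}\sqrt{\frac{\operatorname{Var}[S_N]}{N(D(N)+1)}}.$$ Assume that $v_N>0$ for every $N$ large enough. Consider the following conditions. (a) $\delta\in(2,3)$, $Y_{N,k}\in L^\delta$ for all $N,k$, and $\dfrac{1}{\xi_\delta(N)}\left(\dfrac{D(N)+1}{N}\right)^{\frac12-\frac1\delta}\to0$ as $N\to\infty$. (b) $\delta\in[3,\infty)$, $Y_{N,k}\in L^\delta$ for all $N,k$, and both $\xi_\delta(N)^{-1}\left(\dfrac{D(N)+1}{N}\right)^{\frac12-\frac1\delta}\to0$ and $\xi_\delta(N)^{-3}\sqrt{\dfrac{D(N)+1}{N}}\to0$ as $N\to\infty$. (c) $\sup_{N\in\mathbb{N},\,1\le k\le N}\|Y_{N,k}-c_{N,k}\|_\infty<\infty$,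 and both $\dfrac{D(N)+1}{v_N}\to0$ and $\dfrac{N(D(N)+1)^2}{v_N^3}\to0$ as $N\to\infty$. If (a) or (b) holds for some $\delta$, or if (c) holds, then $W_N\to\mathcal{N}(0,1)$ in distribution as $N\to\infty$. Moreover, if (c) holds, or if for some $\delta$ one has $\liminf_{N\to\infty}\mathcal{A}_\delta(N)>0$ and (a) or (b) holds with this $\delta$, then $$\frac{S_N-\mathbb{E}[S_N]}{\operatorname{Var}[S_N]}\to0\quad\text{in probability as }N\to\infty.$$
   Context: $\mathbb{N}=\{1,2,\dots\}$. A multigraph on a finite set $V$ (multiple edges and loops allowed; simple graphs included) is a dependency graph of a family $(Y_k)_{k\in V}$ of random variables if, whenever $V_1,V_2\subset V$ are disjoint and no edge has one endpoint in $V_1$ and the other in $V_2$, the families $(Y_k)_{k\in V_1}$ and $(Y_k)_{k\in V_2}$ are independent. The degree of a vertex is the number of edges it belongs to, and the maximal degree is the maximum over all vertices. $\|\cdot\|_\infty$ is the $L^\infty$ norm of a random variable. *)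

theory Defs
  imports "HOL-Probability.Probability" "HOL-Library.Uprod" "HOL-Library.Multiset"
begin

text \<open>
  A finite multigraph on \<open>V\<close> is its multiset of edges. An edge is an unordered pair of
  vertices; the pair \<open>Upair x x\<close> is a loop at \<open>x\<close>.
\<close>

definition multigraph_on :: "'v set \<Rightarrow> 'v uprod multiset \<Rightarrow> bool" where
  "multigraph_on V G \<longleftrightarrow> finite V \<and> (\<forall>e \<in># G. set_uprod e \<subseteq> V)"

text \<open>Edges are counted with multiplicity, but a loop contributes only 1 to the degree.\<close>

definition mdegree :: "'v uprod multiset \<Rightarrow> 'v \<Rightarrow> nat" where
  "mdegree G x = size {#e \<in># G. x \<in> set_uprod e#}"

definition max_mdegree :: "'v set \<Rightarrow> 'v uprod multiset \<Rightarrow> nat" where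
  "max_mdegree V G = Max (mdegree G ` V)"

definition dependency_graph ::
  "'a measure \<Rightarrow> 'v set \<Rightarrow> ('v \<Rightarrow> 'a \<Rightarrow> real) \<Rightarrow> 'v uprod multiset \<Rightarrow> bool" where
  "dependency_graph M V Y G \<longleftrightarrow> multigraph_on V G \<and>
    (\<forall>V1 V2. V1 \<subseteq> V \<longrightarrow> V2 \<subseteq> V \<longrightarrow> V1 \<inter> V2 = {} \<longrightarrow>
       \<not> (\<exists>e \<in># G. \<exists>x \<in> V1. \<exists>y \<in> V2. e = Upair x y) \<longrightarrow>
       prob_space.indep_var M
         (PiM V1 (\<lambda>_. borel)) (\<lambda>\<omega>. \<lambda>k\<in>V1. Y k \<omega>)
         (PiM V2 (\<lambda>_. borel)) (\<lambda>\<omega>. \<lambda>k\<in>V2. Y k \<omega>))"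

text \<open>
  The rows of a triangular array are indexed by \<open>N \<ge> 1\<close>, and the variables of row \<open>N\<close>
  live on the probability space \<open>M N\<close>. Nothing relates different rows; the case of one
  common space is the case of constant \<open>M\<close>.
\<close>

definition row_sum :: "(nat \<Rightarrow> nat \<Rightarrow> 'a \<Rightarrow> real) \<Rightarrow> nat \<Rightarrow> 'a \<Rightarrow> real" where
  "row_sum Y N \<omega> = (\<Sum>k=1..N. Y N k \<omega>)"

definition row_mean :: "(nat \<Rightarrow> 'a measure) \<Rightarrow> (nat \<Rightarrow> nat \<Rightarrow> 'a \<Rightarrow> real) \<Rightarrow> nat \<Rightarrow> real" where
  "row_mean M Y N = prob_space.expectation (M N) (row_sum Y N)"

definition row_var :: "(nat \<Rightarrow> 'a measure) \<Rightarrow> (nat \<Rightarrow> nat \<Rightarrow> 'a \<Rightarrow> real) \<Rightarrow> nat \<Rightarrow> real" where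
  "row_var M Y N = prob_space.variance (M N) (row_sum Y N)"

definition row_sd :: "(nat \<Rightarrow> 'a measure) \<Rightarrow> (nat \<Rightarrow> nat \<Rightarrow> 'a \<Rightarrow> real) \<Rightarrow> nat \<Rightarrow> real" where
  "row_sd M Y N = sqrt (row_var M Y N)"

definition row_standardized ::
  "(nat \<Rightarrow> 'a measure) \<Rightarrow> (nat \<Rightarrow> nat \<Rightarrow> 'a \<Rightarrow> real) \<Rightarrow> nat \<Rightarrow> 'a \<Rightarrow> real" where
  "row_standardized M Y N \<omega> = (row_sum Y N \<omega> - row_mean M Y N) / row_sd M Y N"

definition abs_moment_sum ::
  "(nat \<Rightarrow> 'a measure) \<Rightarrow> (nat \<Rightarrow> nat \<Rightarrow> 'a \<Rightarrow> real) \<Rightarrow> (nat \<Rightarrow> nat \<Rightarrow> real) \<Rightarrow> real \<Rightarrow> nat \<Rightarrow> real" where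
  "abs_moment_sum M Y c \<delta> N =
     (\<Sum>k=1..N. prob_space.expectation (M N) (\<lambda>\<omega>. \<bar>Y N k \<omega> - c N k\<bar> powr \<delta>))"

text \<open>
  The convention \<open>x / 0 = 0\<close> does not matter below: under the moment assumptions
  \<open>abs_moment_sum M Y c \<delta> N = 0\<close> forces \<open>row_sd M Y N = 0\<close>, which the
  theorem excludes for large \<open>N\<close>, and only large \<open>N\<close> enter the limits.
\<close>

definition xi ::
  "(nat \<Rightarrow> 'a measure) \<Rightarrow> (nat \<Rightarrow> nat \<Rightarrow> 'a \<Rightarrow> real) \<Rightarrow> (nat \<Rightarrow> nat \<Rightarrow> real) \<Rightarrow> (nat \<Rightarrow> nat)
     \<Rightarrow> real \<Rightarrow> nat \<Rightarrow> real" where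
  "xi M Y c D \<delta> N =
     (real N / abs_moment_sum M Y c \<delta> N) powr (1 / \<delta>)
       * sqrt (row_var M Y N / (real N * (real (D N) + 1)))"

definition all_in_Lp :: "(nat \<Rightarrow> 'a measure) \<Rightarrow> (nat \<Rightarrow> nat \<Rightarrow> 'a \<Rightarrow> real) \<Rightarrow> real \<Rightarrow> bool" where
  "all_in_Lp M Y \<delta> \<longleftrightarrow>
     (\<forall>N k. 1 \<le> k \<and> k \<le> N \<longrightarrow> integrable (M N) (\<lambda>\<omega>. \<bar>Y N k \<omega>\<bar> powr \<delta>))"

definition Linf_norm :: "'a measure \<Rightarrow> ('a \<Rightarrow> real) \<Rightarrow> ereal" where
  "Linf_norm M X = esssup M (\<lambda>\<omega>. ereal \<bar>X \<omega>\<bar>)"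

definition cond_a ::
  "(nat \<Rightarrow> 'a measure) \<Rightarrow> (nat \<Rightarrow> nat \<Rightarrow> 'a \<Rightarrow> real) \<Rightarrow> (nat \<Rightarrow> nat \<Rightarrow> real) \<Rightarrow> (nat \<Rightarrow> nat)
     \<Rightarrow> real \<Rightarrow> bool" where
  "cond_a M Y c D \<delta> \<longleftrightarrow> 2 < \<delta> \<and> \<delta> < 3 \<and> all_in_Lp M Y \<delta> \<and>
     (\<lambda>N. 1 / xi M Y c D \<delta> N * ((real (D N) + 1) / real N) powr (1/2 - 1/\<delta>)) \<longlonglongrightarrow> 0"

definition cond_b ::
  "(nat \<Rightarrow> 'a measure) \<Rightarrow> (nat \<Rightarrow> nat \<Rightarrow> 'a \<Rightarrow> real) \<Rightarrow> (nat \<Rightarrow> nat \<Rightarrow> real) \<Rightarrow> (nat \<Rightarrow> nat)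
     \<Rightarrow> real \<Rightarrow> bool" where
  "cond_b M Y c D \<delta> \<longleftrightarrow> 3 \<le> \<delta> \<and> all_in_Lp M Y \<delta> \<and>
     (\<lambda>N. 1 / xi M Y c D \<delta> N * ((real (D N) + 1) / real N) powr (1/2 - 1/\<delta>)) \<longlonglongrightarrow> 0 \<and>
     (\<lambda>N. 1 / xi M Y c D \<delta> N ^ 3 * sqrt ((real (D N) + 1) / real N)) \<longlonglongrightarrow> 0"

definition cond_c ::
  "(nat \<Rightarrow> 'a measure) \<Rightarrow> (nat \<Rightarrow> nat \<Rightarrow> 'a \<Rightarrow> real) \<Rightarrow> (nat \<Rightarrow> nat \<Rightarrow> real) \<Rightarrow> (nat \<Rightarrow> nat)
     \<Rightarrow> bool" where
  "cond_c M Y c D \<longleftrightarrow>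
     (SUP (N, k) \<in> {(N, k). 1 \<le> k \<and> k \<le> N}. Linf_norm (M N) (\<lambda>\<omega>. Y N k \<omega> - c N k)) < \<infinity> \<and>
     (\<lambda>N. (real (D N) + 1) / row_sd M Y N) \<longlonglongrightarrow> 0 \<and>
     (\<lambda>N. real N * (real (D N) + 1)\<^sup>2 / row_sd M Y N ^ 3) \<longlonglongrightarrow> 0"

definition tends_to_zero_in_prob :: "(nat \<Rightarrow> 'a measure) \<Rightarrow> (nat \<Rightarrow> 'a \<Rightarrow> real) \<Rightarrow> bool" where
  "tends_to_zero_in_prob M X \<longleftrightarrow>
     (\<forall>\<epsilon>>0. (\<lambda>N. measure (M N) {\<omega> \<in> space (M N). \<bar>X N \<omega>\<bar> > \<epsilon>}) \<longlonglongrightarrow> 0)"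

end

theory Submission
  imports Defs
begin

text \<open>
  Replacing \<open>Y\<close> by \<open>X = Y - c\<close> changes neither the centred sum nor the dependency graph. Write
  \<open>B\<close> for the maximal degree plus one, which bounds the number of variables that may depend on a
  given one, and \<open>v\<close> for the standard deviation of the sum. Cut each variable at the level
  \<open>T = v / B\<close>.

  The variance of a sum is at most \<open>B\<close> times the sum of the second moments, as only
  neighbours are correlated. Hence the large parts \<open>X * 1{\<bar>X\<bar> > T}\<close> are negligible, relative to
  \<open>v\<^sup>2\<close>, as soon as \<open>B / v\<^sup>2\<close> times the sum of their second moments tends to zero.

  For the truncated, centred and normalized variables \<open>Z k\<close> with sum \<open>W\<close>, Stein's method is
  applied directly to \<open>\<phi>(t) = E exp(i t W)\<close>, so that no Stein equation has to be solved.
  Its derivative is \<open>i\<close> times the sum of \<open>E[Z k exp(i t W)]\<close>. If the neighbours of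
  \<open>k\<close> are removed from \<open>W\<close>, this expectation becomes zero by independence, and the first-order
  correction is \<open>i t\<close> times the sum of \<open>E[Z k Z j exp(i t W)]\<close> over the neighbours \<open>j\<close>.
  Removing also the neighbours of \<open>j\<close> decouples \<open>Z k Z j\<close> from the exponential, and the
  products \<open>E[Z k Z j]\<close> add up to the variance \<open>s\<close> of \<open>W\<close>
  (\<open>single_error\<close>, \<open>pair_error\<close>). All errors are expectations of products of three variables,
  so that \<open>\<bar>\<phi>'(t) + s t \<phi>(t)\<bar>\<close> is at most \<open>5 t\<^sup>2 B\<^sup>2\<close> times the sum of the third absolute
  moments (\<open>stein_identity_error\<close>). Integrating this differential inequality gives
  \<open>cf_normal_approximation\<close>, and adding the tails gives the quantitative bound
  \<open>normal_approximation\<close>. By Levy's continuity theorem, \<open>W\<close> is asymptotically normal if both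
  \<open>B / v\<^sup>2\<close> times the second moments of the tails and \<open>B\<^sup>2 / v\<^sup>3\<close> times the third moments of the
  truncated variables tend to zero (\<open>central_limit_theorem\<close>).

  It remains to verify these two hypotheses. With the sum \<open>A\<close> of the \<open>\<delta>\<close>-th
  absolute moments, the first moment condition says that
  \<open>r = A\<^bsup>1/\<delta>\<^esup> B\<^bsup>1-1/\<delta>\<^esup> / v\<close> tends to zero. At the chosen level, the tails are
  bounded by \<open>r\<^bsup>\<delta>\<^esup>\<close>, and so are the truncated third moments if \<open>\<delta> < 3\<close>. If \<open>\<delta> \<ge> 3\<close>, Jensen's
  inequality bounds the third moments by the quantity in the second moment condition. In the bounded
  case \<open>T\<close> tends to infinity, the tails eventually vanish, and the sum of the third moments is at
  most a constant times the number of variables.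

  The last claim needs only that \<open>v\<close> tends to infinity, by Chebyshev's inequality. This is clear
  from the first condition in the bounded case, and follows from \<open>r\<close> tending to zero and
  \<open>B \<ge> 1\<close> if \<open>A\<close> is bounded away from zero.
\<close>

section \<open>Bounded random variables\<close>

text \<open>
  Closure of this class under algebraic operations disposes of all integrability questions
  for the truncated variables. The bound is required everywhere and not almost everywhere,
  so that the closure rules need no null sets.
\<close>
definition bounded_rv :: "'a measure \<Rightarrow> ('a \<Rightarrow> 'b::{real_normed_field,banach,second_countable_topology}) \<Rightarrow> bool" where
  "bounded_rv M f \<longleftrightarrow> f \<in> borel_measurable M \<and> (\<exists>K. \<forall>\<omega>. norm (f \<omega>) \<le> K)"

lemma bounded_rvI: "f \<in> borel_measurable M \<Longrightarrow> (\<And>\<omega>. norm (f \<omega>) \<le> K) \<Longrightarrow> bounded_rv M f"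
  unfolding bounded_rv_def by blast

lemma bounded_rv_const: "bounded_rv M (\<lambda>_. a)"
  by (rule bounded_rvI[where K = "norm a"]) auto

lemma bounded_rv_mult:
  assumes "bounded_rv M f" "bounded_rv M g"
  shows "bounded_rv M (\<lambda>\<omega>. f \<omega> * g \<omega>)"
proof -
  from assms obtain K L where K: "\<And>\<omega>. norm (f \<omega>) \<le> K" and L: "\<And>\<omega>. norm (g \<omega>) \<le> L"
    unfolding bounded_rv_def by blast
  have [measurable]: "f \<in> borel_measurable M" "g \<in> borel_measurable M"
    using assms unfolding bounded_rv_def by auto
  show ?thesis
  proof (rule bounded_rvI)
    show "norm (f \<omega> * g \<omega>) \<le> K * L" for \<omega>
      unfolding norm_mult using K[of \<omega>] L[of \<omega>] norm_ge_zero[of "f \<omega>"]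
      by (intro mult_mono) (auto intro: order_trans[OF norm_ge_zero])
  qed simp
qed

lemma bounded_rv_add:
  assumes "bounded_rv M f" "bounded_rv M g"
  shows "bounded_rv M (\<lambda>\<omega>. f \<omega> + g \<omega>)"
proof -
  from assms obtain K L where K: "\<And>\<omega>. norm (f \<omega>) \<le> K" and L: "\<And>\<omega>. norm (g \<omega>) \<le> L"
    unfolding bounded_rv_def by blast
  have [measurable]: "f \<in> borel_measurable M" "g \<in> borel_measurable M"
    using assms unfolding bounded_rv_def by auto
  show ?thesis
    by (rule bounded_rvI[where K = "K + L"]) (auto intro!: norm_triangle_mono K L)
qed

lemma bounded_rv_diff:
  assumes "bounded_rv M f" "bounded_rv M g"
  shows "bounded_rv M (\<lambda>\<omega>. f \<omega> - g \<omega>)"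
  using bounded_rv_add[OF assms(1) bounded_rv_mult[OF bounded_rv_const[of M "-1"] assms(2)]] by simp

lemma bounded_rv_sum:
  assumes "\<And>i. i \<in> I \<Longrightarrow> bounded_rv M (f i)"
  shows "bounded_rv M (\<lambda>\<omega>. \<Sum>i\<in>I. f i \<omega>)"
  using assms
  by (induction I rule: infinite_finite_induct)
    (simp_all add: bounded_rv_const bounded_rv_add)

lemma bounded_rv_abs: "bounded_rv M f \<Longrightarrow> bounded_rv M (\<lambda>\<omega>. \<bar>f \<omega> :: real\<bar>)"
  unfolding bounded_rv_def by auto

lemma bounded_rv_power: "bounded_rv M f \<Longrightarrow> bounded_rv M (\<lambda>\<omega>. f \<omega> ^ n)"
  by (induction n) (simp_all add: bounded_rv_const bounded_rv_mult)

lemma bounded_rv_divide: "bounded_rv M f \<Longrightarrow> bounded_rv M (\<lambda>\<omega>. f \<omega> / a)"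
  using bounded_rv_mult[OF _ bounded_rv_const[of M "inverse a"]] by (simp add: field_class.field_divide_inverse)

lemma bounded_rv_complex: "bounded_rv M f \<Longrightarrow> bounded_rv M (\<lambda>\<omega>. complex_of_real (f \<omega>))"
  unfolding bounded_rv_def by auto

lemma bounded_rv_iexp: "f \<in> borel_measurable M \<Longrightarrow> bounded_rv M (\<lambda>\<omega>. iexp (f \<omega>))"
  by (rule bounded_rvI[where K = 1]) auto

lemma bounded_rv_measurable: "bounded_rv M f \<Longrightarrow> f \<in> borel_measurable M"
  unfolding bounded_rv_def by auto

lemmas bounded_rv_intros = bounded_rv_const bounded_rv_mult bounded_rv_add bounded_rv_diff
  bounded_rv_sum bounded_rv_abs bounded_rv_power bounded_rv_divide bounded_rv_complex bounded_rv_iexp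

lemma (in prob_space) integrable_bounded_rv: "bounded_rv M f \<Longrightarrow> integrable M f"
  unfolding bounded_rv_def by (auto intro: integrable_const_bound)

section \<open>Elementary estimates\<close>

lemma iexp_first_order: "cmod (iexp x - 1) \<le> \<bar>x\<bar>"
  using iexp_approx1[of x 0] by simp

lemma iexp_second_order: "cmod (iexp x - 1 - \<i> * x) \<le> x\<^sup>2 / 2"
  using iexp_approx1[of x 1] by (simp add: numeral_2_eq_2 algebra_simps)

lemma cmod_iexp_diff: "cmod (iexp x - iexp y) \<le> \<bar>x - y\<bar>"
proof -
  have "iexp x - iexp y = iexp y * (iexp (x - y) - 1)"
    by (simp add: algebra_simps flip: exp_add)
  then show ?thesis using iexp_first_order[of "x - y"] by (simp add: norm_mult)
qed

text \<open>
  Removing a summand \<open>u\<close> from the exponent costs a linear term and a quadratic remainder.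
  The linear term keeps the full exponential \<open>iexp x\<close>, so that it can be recombined with the
  other summands in the Stein argument.
\<close>
lemma cmod_iexp_remainder: "cmod (iexp x - iexp (x - u) - \<i> * u * iexp x) \<le> u\<^sup>2 / 2"
proof -
  have "iexp x - iexp (x - u) - \<i> * u * iexp x = - (iexp x * (iexp (- u) - 1 - \<i> * (- u)))"
    by (simp add: algebra_simps flip: exp_add)
  then show ?thesis using iexp_second_order[of "- u"] by (simp only: norm_minus_cancel norm_mult) simp
qed

lemma arith_geo_mean_3:
  fixes a b c :: real
  assumes "0 \<le> a" "0 \<le> b" "0 \<le> c"
  shows "a * b * c \<le> (a ^ 3 + b ^ 3 + c ^ 3) / 3"
proof -
  have "a^3 + b^3 + c^3 - 3 * (a * b * c) = (a + b + c) * ((a - b)\<^sup>2 + (b - c)\<^sup>2 + (c - a)\<^sup>2) / 2"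
    by (simp add: algebra_simps power2_eq_square power3_eq_cube)
  moreover have "\<dots> \<ge> 0" using assms by simp
  ultimately show ?thesis by simp
qed

lemma abs_arith_geo_mean_3: "\<bar>a * b * c :: real\<bar> \<le> (\<bar>a\<bar> ^ 3 + \<bar>b\<bar> ^ 3 + \<bar>c\<bar> ^ 3) / 3"
  using arith_geo_mean_3[of "\<bar>a\<bar>" "\<bar>b\<bar>" "\<bar>c\<bar>"] by (simp add: abs_mult)

section \<open>Dependency neighbourhoods\<close>

text \<open>
  The form in which a dependency graph enters the proof: a set \<open>A\<close> of indices is independent
  of everything outside the neighbourhoods of its elements. Every index belongs to its own
  neighbourhood, so \<open>B\<close> corresponds to the maximal degree plus one.
\<close>
locale dependency_neighbourhoods = prob_space M
  for M :: "'a measure" +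
  fixes V :: "'v set" and nb :: "'v \<Rightarrow> 'v set" and B :: real and X :: "'v \<Rightarrow> 'a \<Rightarrow> real"
  assumes finite_V: "finite V"
    and nb_subset: "k \<in> V \<Longrightarrow> nb k \<subseteq> V"
    and self_in_nb: "k \<in> V \<Longrightarrow> k \<in> nb k"
    and nb_sym: "k \<in> V \<Longrightarrow> j \<in> nb k \<Longrightarrow> k \<in> nb j"
    and card_nb: "k \<in> V \<Longrightarrow> real (card (nb k)) \<le> B"
    and rv_X: "k \<in> V \<Longrightarrow> X k \<in> borel_measurable M"
    and indep_far: "A \<subseteq> V \<Longrightarrow> indep_var
       (PiM A (\<lambda>_. borel)) (\<lambda>\<omega>. \<lambda>k\<in>A. X k \<omega>)
       (PiM (V - \<Union>(nb ` A)) (\<lambda>_. borel)) (\<lambda>\<omega>. \<lambda>k\<in>V - \<Union>(nb ` A). X k \<omega>)"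
begin

lemma finite_nb: "k \<in> V \<Longrightarrow> finite (nb k)"
  using finite_V nb_subset finite_subset by blast

lemma nb_sum_swap:
  fixes f :: "'v \<Rightarrow> 'v \<Rightarrow> real"
  shows "(\<Sum>k\<in>V. \<Sum>j\<in>nb k. f k j) = (\<Sum>j\<in>V. \<Sum>k\<in>nb j. f k j)"
proof -
  have "(\<Sum>k\<in>V. \<Sum>j\<in>nb k. f k j) = (\<Sum>(k,j)\<in>Sigma V nb. f k j)"
    using finite_V finite_nb by (intro sum.Sigma) auto
  also have "\<dots> = (\<Sum>(j,k)\<in>Sigma V nb. f k j)"
    by (rule sum.reindex_bij_witness[where i = "\<lambda>(k,j). (j,k)" and j = "\<lambda>(k,j). (j,k)"])
      (use nb_sym nb_subset in auto)
  also have "\<dots> = (\<Sum>j\<in>V. \<Sum>k\<in>nb j. f k j)"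
    using finite_V finite_nb by (intro sum.Sigma[symmetric]) auto
  finally show ?thesis .
qed

lemma B_nonneg: "V \<noteq> {} \<Longrightarrow> 0 \<le> B"
  using card_nb by (metis all_not_in_conv of_nat_0_le_iff order_trans)

lemma nb_sum_const_le:
  fixes f :: "'v \<Rightarrow> real"
  assumes "\<And>k. k \<in> V \<Longrightarrow> 0 \<le> f k"
  shows "(\<Sum>k\<in>V. \<Sum>j\<in>nb k. f k) \<le> B * (\<Sum>k\<in>V. f k)"
  using assms card_nb by (auto simp: sum_distrib_left intro!: sum_mono mult_right_mono)

lemma nb_sum_le:
  fixes f :: "'v \<Rightarrow> real"
  assumes "\<And>k. k \<in> V \<Longrightarrow> 0 \<le> f k"
  shows "(\<Sum>k\<in>V. \<Sum>j\<in>nb k. f j) \<le> B * (\<Sum>k\<in>V. f k)"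
  using nb_sum_const_le[OF assms] by (simp add: nb_sum_swap)

text \<open>
  The error terms of the Stein argument are indexed by \<open>k\<close>, a neighbour \<open>j\<close> of \<open>k\<close>, and an
  index \<open>l\<close> adjacent to one of the two. Each index lies in at most \<open>B\<^sup>2\<close> stars
  \<open>(k, j, l)\<close> with \<open>j, l\<close> adjacent to \<open>k\<close>, in each of the three positions; the
  case where \<open>l\<close> is adjacent to \<open>j\<close> is a star centred at \<open>j\<close>. This gives the factor 2.
\<close>
lemma nb_triple_sum_le:
  fixes m :: "'v \<Rightarrow> real"
  assumes m: "\<And>k. k \<in> V \<Longrightarrow> 0 \<le> m k"
  shows "(\<Sum>k\<in>V. \<Sum>j\<in>nb k. \<Sum>l\<in>nb k \<union> nb j. (m k + m j + m l) / 3) \<le> 2 * B\<^sup>2 * (\<Sum>k\<in>V. m k)"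
proof (cases "V = {}")
  case False
  note B0 = B_nonneg[OF False]
  let ?h = "\<lambda>k j l. (m k + m j + m l) / 3"
  have in_V: "j \<in> V" if "k \<in> V" "j \<in> nb k" for k j using that nb_subset by blast
  have nn: "0 \<le> (\<Sum>l\<in>nb k. m l)" if "k \<in> V" for k
    using that in_V m by (intro sum_nonneg) auto
  have star: "(\<Sum>k\<in>V. \<Sum>j\<in>nb k. \<Sum>l\<in>nb k. ?h k j l) \<le> B\<^sup>2 * (\<Sum>k\<in>V. m k)"
  proof -
    have "(\<Sum>j\<in>nb k. \<Sum>l\<in>nb k. ?h k j l) \<le> (B * (\<Sum>j\<in>nb k. m k) + 2 * B * (\<Sum>j\<in>nb k. m j)) / 3"
      if k: "k \<in> V" for k
    proof -
      have "(\<Sum>j\<in>nb k. \<Sum>l\<in>nb k. ?h k j l) = ((\<Sum>j\<in>nb k. \<Sum>l\<in>nb k. m k)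
          + (\<Sum>j\<in>nb k. \<Sum>l\<in>nb k. m j) + (\<Sum>j\<in>nb k. \<Sum>l\<in>nb k. m l)) / 3"
        by (simp only: sum.distrib flip: sum_divide_distrib)
      also have "\<dots> = (real (card (nb k)) * (\<Sum>j\<in>nb k. m k) + 2 * real (card (nb k)) * (\<Sum>j\<in>nb k. m j)) / 3"
        by (simp flip: sum_distrib_left)
      also have "\<dots> \<le> (B * (\<Sum>j\<in>nb k. m k) + 2 * B * (\<Sum>j\<in>nb k. m j)) / 3"
        using card_nb[OF k] nn[OF k] m[OF k] B0
        by (intro divide_right_mono add_mono mult_right_mono) auto
      finally show ?thesis .
    qed
    then have "(\<Sum>k\<in>V. \<Sum>j\<in>nb k. \<Sum>l\<in>nb k. ?h k j l)
        \<le> (\<Sum>k\<in>V. (B * (\<Sum>j\<in>nb k. m k) + 2 * B * (\<Sum>j\<in>nb k. m j)) / 3)"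
      by (rule sum_mono)
    also have "\<dots> = (B * (\<Sum>k\<in>V. \<Sum>j\<in>nb k. m k) + 2 * B * (\<Sum>k\<in>V. \<Sum>j\<in>nb k. m j)) / 3"
      by (simp add: sum.distrib sum_distrib_left flip: sum_divide_distrib)
    also have "\<dots> \<le> (B * (B * (\<Sum>k\<in>V. m k)) + 2 * B * (B * (\<Sum>k\<in>V. m k))) / 3"
      using nb_sum_const_le[of m] nb_sum_le[of m] m B0
      by (intro divide_right_mono add_mono mult_left_mono) auto
    also have "\<dots> = B\<^sup>2 * (\<Sum>k\<in>V. m k)" by (simp add: power2_eq_square)
    finally show ?thesis .
  qed
  have "(\<Sum>k\<in>V. \<Sum>j\<in>nb k. \<Sum>l\<in>nb k \<union> nb j. ?h k j l)
      \<le> (\<Sum>k\<in>V. \<Sum>j\<in>nb k. (\<Sum>l\<in>nb k. ?h k j l) + (\<Sum>l\<in>nb j. ?h k j l))"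
  proof (intro sum_mono)
    fix k j assume kj: "k \<in> V" "j \<in> nb k"
    then have j: "j \<in> V" using in_V by blast
    have "0 \<le> (\<Sum>l\<in>nb k \<inter> nb j. ?h k j l)"
      using kj j in_V m by (intro sum_nonneg divide_nonneg_nonneg add_nonneg_nonneg) auto
    then show "(\<Sum>l\<in>nb k \<union> nb j. ?h k j l) \<le> (\<Sum>l\<in>nb k. ?h k j l) + (\<Sum>l\<in>nb j. ?h k j l)"
      using sum.union_inter[OF finite_nb[OF kj(1)] finite_nb[OF j], of "?h k j"] by linarith
  qed
  also have "\<dots> = (\<Sum>k\<in>V. \<Sum>j\<in>nb k. \<Sum>l\<in>nb k. ?h k j l) + (\<Sum>k\<in>V. \<Sum>j\<in>nb k. \<Sum>l\<in>nb j. ?h k j l)"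
    by (simp add: sum.distrib)
  also have "(\<Sum>k\<in>V. \<Sum>j\<in>nb k. \<Sum>l\<in>nb j. ?h k j l) = (\<Sum>k\<in>V. \<Sum>j\<in>nb k. \<Sum>l\<in>nb k. ?h k j l)"
    by (subst nb_sum_swap) (simp add: add.commute)
  finally show ?thesis using star by simp
qed simp

lemma far_expectation_mult:
  fixes F G :: "('v \<Rightarrow> real) \<Rightarrow> 'b::{real_normed_field,banach,second_countable_topology}"
  assumes A: "A \<subseteq> V"
    and F: "F \<in> borel_measurable (PiM A (\<lambda>_. borel))"
    and G: "G \<in> borel_measurable (PiM (V - \<Union>(nb ` A)) (\<lambda>_. borel))"
    and "integrable M (\<lambda>\<omega>. F (\<lambda>k\<in>A. X k \<omega>))"
    and "integrable M (\<lambda>\<omega>. G (\<lambda>k\<in>V - \<Union>(nb ` A). X k \<omega>))"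
  shows "(LINT \<omega>|M. F (\<lambda>k\<in>A. X k \<omega>) * G (\<lambda>k\<in>V - \<Union>(nb ` A). X k \<omega>))
       = (LINT \<omega>|M. F (\<lambda>k\<in>A. X k \<omega>)) * (LINT \<omega>|M. G (\<lambda>k\<in>V - \<Union>(nb ` A). X k \<omega>))"
  using indep_var_lebesgue_integral[OF indep_var_compose[OF indep_far[OF A] F G]] assms(4,5)
  by (simp add: comp_def)

text \<open>
  Truncation, centring and scaling act on each variable separately, and so preserve the
  dependency structure.
\<close>
lemma componentwise_transform:
  assumes f: "\<And>k. k \<in> V \<Longrightarrow> f k \<in> borel_measurable borel"
  shows "dependency_neighbourhoods M V nb B (\<lambda>k \<omega>. f k (X k \<omega>))"
proof
  fix A assume A: "A \<subseteq> V"
  have F: "(\<lambda>x. \<lambda>k\<in>L. f k (x k)) \<in> PiM L (\<lambda>_. borel) \<rightarrow>\<^sub>M PiM L (\<lambda>_. borel)" if "L \<subseteq> V" for L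
    using that f by (intro measurable_restrict measurable_compose[OF measurable_component_singleton]) auto
  have "indep_var (PiM A (\<lambda>_. borel)) ((\<lambda>x. \<lambda>k\<in>A. f k (x k)) \<circ> (\<lambda>\<omega>. \<lambda>k\<in>A. X k \<omega>))
       (PiM (V - \<Union>(nb ` A)) (\<lambda>_. borel))
       ((\<lambda>x. \<lambda>k\<in>V - \<Union>(nb ` A). f k (x k)) \<circ> (\<lambda>\<omega>. \<lambda>k\<in>V - \<Union>(nb ` A). X k \<omega>))"
    using A by (intro indep_var_compose[OF indep_far] F) auto
  also have "(\<lambda>x. \<lambda>k\<in>A. f k (x k)) \<circ> (\<lambda>\<omega>. \<lambda>k\<in>A. X k \<omega>) = (\<lambda>\<omega>. \<lambda>k\<in>A. f k (X k \<omega>))"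
    by (auto simp: fun_eq_iff)
  also have "(\<lambda>x. \<lambda>k\<in>V - \<Union>(nb ` A). f k (x k)) \<circ> (\<lambda>\<omega>. \<lambda>k\<in>V - \<Union>(nb ` A). X k \<omega>)
     = (\<lambda>\<omega>. \<lambda>k\<in>V - \<Union>(nb ` A). f k (X k \<omega>))"
    by (auto simp: fun_eq_iff)
  finally show "indep_var (PiM A (\<lambda>_. borel)) (\<lambda>\<omega>. \<lambda>k\<in>A. f k (X k \<omega>))
       (PiM (V - \<Union>(nb ` A)) (\<lambda>_. borel)) (\<lambda>\<omega>. \<lambda>k\<in>V - \<Union>(nb ` A). f k (X k \<omega>))" .
qed (use finite_V nb_subset self_in_nb nb_sym card_nb rv_X f in \<open>auto intro: measurable_compose\<close>)

lemma far_uncorrelated: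
  assumes "k \<in> V" "j \<in> V" "j \<notin> nb k" "integrable M (X k)" "integrable M (X j)"
  shows "expectation (\<lambda>\<omega>. X k \<omega> * X j \<omega>) = expectation (X k) * expectation (X j)"
proof -
  have j: "j \<in> V - \<Union>(nb ` {k})" using assms by auto
  show ?thesis
    using far_expectation_mult[of "{k}" "\<lambda>x. x k" "\<lambda>x. x j"] assms j by simp
qed

text \<open>
  Only pairs of neighbours contribute to the variance, and
  \<open>2 * x * y \<le> x\<^sup>2 + y\<^sup>2\<close> turns each contribution into single second moments, each
  of which is counted at most \<open>B\<close> times from either side.
\<close>
lemma second_moment_sum:
  assumes centred: "\<And>k. k \<in> V \<Longrightarrow> expectation (X k) = 0"
    and sq: "\<And>k. k \<in> V \<Longrightarrow> integrable M (\<lambda>\<omega>. (X k \<omega>)\<^sup>2)"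
  shows "integrable M (\<lambda>\<omega>. (\<Sum>k\<in>V. X k \<omega>)\<^sup>2)"
    and "expectation (\<lambda>\<omega>. (\<Sum>k\<in>V. X k \<omega>)\<^sup>2) = (\<Sum>k\<in>V. \<Sum>j\<in>nb k. expectation (\<lambda>\<omega>. X k \<omega> * X j \<omega>))"
    and "expectation (\<lambda>\<omega>. (\<Sum>k\<in>V. X k \<omega>)\<^sup>2) \<le> B * (\<Sum>k\<in>V. expectation (\<lambda>\<omega>. (X k \<omega>)\<^sup>2))"
proof -
  have in_V: "j \<in> V" if "k \<in> V" "j \<in> nb k" for k j using that nb_subset by blast
  have int1: "integrable M (X k)" if "k \<in> V" for k
    using square_integrable_imp_integrable[OF rv_X[OF that] sq[OF that]] .
  have bnd: "\<bar>X k \<omega> * X j \<omega>\<bar> \<le> ((X k \<omega>)\<^sup>2 + (X j \<omega>)\<^sup>2) / 2" for k j \<omega>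
    using sum_squares_bound[of "\<bar>X k \<omega>\<bar>" "\<bar>X j \<omega>\<bar>"] by (simp add: abs_mult)
  have int2: "integrable M (\<lambda>\<omega>. X k \<omega> * X j \<omega>)" if "k \<in> V" "j \<in> V" for k j
  proof (rule Bochner_Integration.integrable_bound)
    show "integrable M (\<lambda>\<omega>. ((X k \<omega>)\<^sup>2 + (X j \<omega>)\<^sup>2) / 2)"
      using that sq by (intro integrable_divide Bochner_Integration.integrable_add) auto
    show "(\<lambda>\<omega>. X k \<omega> * X j \<omega>) \<in> borel_measurable M" using that rv_X by measurable
    show "AE \<omega> in M. norm (X k \<omega> * X j \<omega>) \<le> norm (((X k \<omega>)\<^sup>2 + (X j \<omega>)\<^sup>2) / 2)"
      using bnd[of k _ j] by (intro AE_I2) (auto intro: order_trans)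
  qed
  have exp2: "expectation (\<lambda>\<omega>. X k \<omega> * X j \<omega>)
      \<le> (expectation (\<lambda>\<omega>. (X k \<omega>)\<^sup>2) + expectation (\<lambda>\<omega>. (X j \<omega>)\<^sup>2)) / 2"
    if "k \<in> V" "j \<in> V" for k j
  proof -
    have "expectation (\<lambda>\<omega>. X k \<omega> * X j \<omega>) \<le> expectation (\<lambda>\<omega>. ((X k \<omega>)\<^sup>2 + (X j \<omega>)\<^sup>2) / 2)"
      using that int2 sq order_trans[OF abs_ge_self bnd]
      by (intro integral_mono) auto
    then show ?thesis using that sq by simp
  qed
  have sqr: "(\<Sum>k\<in>V. X k \<omega>)\<^sup>2 = (\<Sum>k\<in>V. \<Sum>j\<in>V. X k \<omega> * X j \<omega>)" for \<omega>
    by (simp add: power2_eq_square sum_product)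
  show "integrable M (\<lambda>\<omega>. (\<Sum>k\<in>V. X k \<omega>)\<^sup>2)"
    unfolding sqr by (intro Bochner_Integration.integrable_sum int2)
  have "expectation (\<lambda>\<omega>. (\<Sum>k\<in>V. X k \<omega>)\<^sup>2) = (\<Sum>k\<in>V. \<Sum>j\<in>V. expectation (\<lambda>\<omega>. X k \<omega> * X j \<omega>))"
    unfolding sqr using int2 by (simp add: integral_sum integrable_sum)
  also have "\<dots> = (\<Sum>k\<in>V. \<Sum>j\<in>nb k. expectation (\<lambda>\<omega>. X k \<omega> * X j \<omega>))"
    using finite_V nb_subset far_uncorrelated int1 centred
    by (intro sum.cong refl sum.mono_neutral_right) auto
  finally show eq: "expectation (\<lambda>\<omega>. (\<Sum>k\<in>V. X k \<omega>)\<^sup>2) = (\<Sum>k\<in>V. \<Sum>j\<in>nb k. expectation (\<lambda>\<omega>. X k \<omega> * X j \<omega>))" .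
  let ?q = "\<lambda>k. expectation (\<lambda>\<omega>. (X k \<omega>)\<^sup>2)"
  have "(\<Sum>k\<in>V. \<Sum>j\<in>nb k. expectation (\<lambda>\<omega>. X k \<omega> * X j \<omega>)) \<le> (\<Sum>k\<in>V. \<Sum>j\<in>nb k. (?q k + ?q j) / 2)"
    using exp2 in_V by (intro sum_mono) auto
  also have "\<dots> = ((\<Sum>k\<in>V. \<Sum>j\<in>nb k. ?q k) + (\<Sum>k\<in>V. \<Sum>j\<in>nb k. ?q j)) / 2"
    by (simp only: sum.distrib flip: sum_divide_distrib)
  also have "\<dots> \<le> B * (\<Sum>k\<in>V. ?q k)"
    using nb_sum_const_le[of ?q] nb_sum_le[of ?q] by simp
  finally show "expectation (\<lambda>\<omega>. (\<Sum>k\<in>V. X k \<omega>)\<^sup>2) \<le> B * (\<Sum>k\<in>V. ?q k)" unfolding eq .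
qed

end

section \<open>Stein's method for the characteristic function\<close>

text \<open>
  Boundedness makes all the expectations below finite, while the errors are measured by the third
  absolute moments \<open>m3\<close>, uniformly in \<open>C\<close>.
\<close>
locale bounded_dependency_neighbourhoods = dependency_neighbourhoods +
  fixes C :: real
  assumes bounded_X: "k \<in> V \<Longrightarrow> \<bar>X k \<omega>\<bar> \<le> C"
    and centred_X: "k \<in> V \<Longrightarrow> expectation (X k) = 0"
begin

definition W :: "'a \<Rightarrow> real" where "W \<omega> = (\<Sum>k\<in>V. X k \<omega>)"

definition m3 :: "'b \<Rightarrow> real" where "m3 k = expectation (\<lambda>\<omega>. \<bar>X k \<omega>\<bar> ^ 3)"

definition cf :: "real \<Rightarrow> complex" where "cf t = (CLINT \<omega>|M. iexp (t * W \<omega>))"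

lemma bounded_rv_X: "k \<in> V \<Longrightarrow> bounded_rv M (X k)"
  using rv_X bounded_X by (intro bounded_rvI) auto

lemma bounded_rv_sum_X: "L \<subseteq> V \<Longrightarrow> bounded_rv M (\<lambda>\<omega>. \<Sum>k\<in>L. X k \<omega>)"
  using bounded_rv_X by (intro bounded_rv_sum) auto

lemma bounded_rv_W: "bounded_rv M W"
  unfolding W_def by (rule bounded_rv_sum_X) simp

lemma measurable_sum_X: "L \<subseteq> V \<Longrightarrow> (\<lambda>\<omega>. \<Sum>k\<in>L. X k \<omega>) \<in> borel_measurable M"
  using bounded_rv_sum_X by (rule bounded_rv_measurable)

lemma measurable_W [measurable]: "W \<in> borel_measurable M"
  using bounded_rv_W by (rule bounded_rv_measurable)

lemma m3_nonneg: "0 \<le> m3 k"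
  unfolding m3_def by (rule Bochner_Integration.integral_nonneg) simp

lemma integrable_m3: "k \<in> V \<Longrightarrow> integrable M (\<lambda>\<omega>. \<bar>X k \<omega>\<bar> ^ 3)"
  by (intro integrable_bounded_rv bounded_rv_intros bounded_rv_X)

lemma expectation_triple_le:
  assumes "k \<in> V" "j \<in> V" "l \<in> V"
  shows "expectation (\<lambda>\<omega>. \<bar>X k \<omega> * X j \<omega> * X l \<omega>\<bar>) \<le> (m3 k + m3 j + m3 l) / 3"
proof -
  have "expectation (\<lambda>\<omega>. \<bar>X k \<omega> * X j \<omega> * X l \<omega>\<bar>)
      \<le> expectation (\<lambda>\<omega>. (\<bar>X k \<omega>\<bar> ^ 3 + \<bar>X j \<omega>\<bar> ^ 3 + \<bar>X l \<omega>\<bar> ^ 3) / 3)"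
    using assms
    by (intro integral_mono abs_arith_geo_mean_3 integrable_bounded_rv bounded_rv_intros bounded_rv_X)
  also have "\<dots> = (m3 k + m3 j + m3 l) / 3"
    using assms integrable_m3 by (simp add: m3_def)
  finally show ?thesis .
qed

text \<open>
  The same bound as for the joint expectation, without Hoelder's inequality: apply the
  arithmetic-geometric mean inequality with the third factor a constant \<open>z\<close>, take the
  expectation, substitute \<open>X l \<omega>\<close> for \<open>z\<close>, and take the expectation again.
\<close>
lemma expectation_split_triple_le:
  assumes "k \<in> V" "j \<in> V" "l \<in> V"
  shows "expectation (\<lambda>\<omega>. \<bar>X k \<omega> * X j \<omega>\<bar>) * expectation (\<lambda>\<omega>. \<bar>X l \<omega>\<bar>) \<le> (m3 k + m3 j + m3 l) / 3"
proof -
  note int3 = integrable_m3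
  have int: "integrable M (\<lambda>\<omega>. \<bar>X k \<omega> * X j \<omega>\<bar>)" "integrable M (\<lambda>\<omega>. \<bar>X l \<omega>\<bar>)"
    using assms by (intro integrable_bounded_rv bounded_rv_intros bounded_rv_X; simp)+
  \<comment> \<open>Written with \<open>\<bar>z\<bar>\<close>, so that any real value of \<open>X l\<close> can be substituted.\<close>
  have fixed: "expectation (\<lambda>\<omega>. \<bar>X k \<omega> * X j \<omega>\<bar>) * \<bar>z\<bar> \<le> (m3 k + m3 j + \<bar>z\<bar> ^ 3) / 3" for z
  proof -
    have "expectation (\<lambda>\<omega>. \<bar>X k \<omega> * X j \<omega>\<bar>) * \<bar>z\<bar> = expectation (\<lambda>\<omega>. \<bar>X k \<omega> * X j \<omega>\<bar> * \<bar>z\<bar>)"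
      using int by simp
    also have "\<dots> \<le> expectation (\<lambda>\<omega>. (\<bar>X k \<omega>\<bar> ^ 3 + \<bar>X j \<omega>\<bar> ^ 3 + \<bar>z\<bar> ^ 3) / 3)"
      using abs_arith_geo_mean_3[of "X k _" "X j _" z] int3 assms int
      by (intro integral_mono) (auto simp: abs_mult)
    also have "\<dots> = (m3 k + m3 j + \<bar>z\<bar> ^ 3) / 3"
      using int3 assms by (simp add: m3_def prob_space)
    finally show ?thesis .
  qed
  have "expectation (\<lambda>\<omega>. \<bar>X k \<omega> * X j \<omega>\<bar>) * expectation (\<lambda>\<omega>. \<bar>X l \<omega>\<bar>)
      = expectation (\<lambda>\<omega>. expectation (\<lambda>\<omega>. \<bar>X k \<omega> * X j \<omega>\<bar>) * \<bar>X l \<omega>\<bar>)"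
    by simp
  also have "\<dots> \<le> expectation (\<lambda>\<omega>. (m3 k + m3 j + \<bar>X l \<omega>\<bar> ^ 3) / 3)"
    using fixed int3 assms int by (intro integral_mono) auto
  also have "\<dots> = (m3 k + m3 j + m3 l) / 3"
    using int3 assms by (simp add: m3_def prob_space)
  finally show ?thesis .
qed

lemma cmod_expectation_le:
  fixes f :: "'a \<Rightarrow> complex" and g :: "'a \<Rightarrow> real"
  assumes "bounded_rv M f" "bounded_rv M g" "\<And>\<omega>. cmod (f \<omega>) \<le> g \<omega>"
  shows "cmod (CLINT \<omega>|M. f \<omega>) \<le> expectation g"
  using assms by (intro order_trans[OF integral_norm_bound] integral_mono)
    (auto intro: integrable_bounded_rv integrable_norm)

lemma bounded_rv_iexp_sum: "L \<subseteq> V \<Longrightarrow> bounded_rv M (\<lambda>\<omega>. iexp (t * (\<Sum>k\<in>L. X k \<omega>)))"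
  by (intro bounded_rv_iexp borel_measurable_times borel_measurable_const measurable_sum_X)

lemma far_iexp:
  fixes f :: "('b \<Rightarrow> real) \<Rightarrow> real"
  assumes A: "A \<subseteq> V" and L: "L = V - \<Union>(nb ` A)"
    and f: "f \<in> borel_measurable (PiM A (\<lambda>_. borel))" and "bounded_rv M (\<lambda>\<omega>. f (\<lambda>k\<in>A. X k \<omega>))"
  shows "(CLINT \<omega>|M. complex_of_real (f (\<lambda>k\<in>A. X k \<omega>)) * iexp (t * (\<Sum>i\<in>L. X i \<omega>)))
    = complex_of_real (expectation (\<lambda>\<omega>. f (\<lambda>k\<in>A. X k \<omega>))) * (CLINT \<omega>|M. iexp (t * (\<Sum>i\<in>L. X i \<omega>)))"
proof -
  have LV: "L \<subseteq> V" using L by auto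
  note * = far_expectation_mult[OF A, of "\<lambda>x. complex_of_real (f x)" "\<lambda>x. iexp (t * (\<Sum>i\<in>L. x i))",
    folded L]
  have r: "(\<Sum>i\<in>L. (\<lambda>k\<in>L. X k \<omega>) i) = (\<Sum>i\<in>L. X i \<omega>)" for \<omega>
    by (auto intro: sum.cong)
  show ?thesis
    unfolding integral_complex_of_real[symmetric]
  proof (rule *[unfolded r])
    show "integrable M (\<lambda>\<omega>. complex_of_real (f (\<lambda>k\<in>A. X k \<omega>)))"
      using assms(4) by (intro integrable_bounded_rv bounded_rv_complex)
    show "integrable M (\<lambda>\<omega>. iexp (t * (\<Sum>i\<in>L. X i \<omega>)))"
      by (intro integrable_bounded_rv bounded_rv_iexp_sum LV)
  qed (use f in measurable)
qed

lemma bounded_rv_iexp_W: "bounded_rv M (\<lambda>\<omega>. iexp (t * W \<omega>))"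
  by (intro bounded_rv_iexp) measurable

text \<open>
  Asymptotic decoupling of the product \<open>X k * X j\<close> from \<open>W\<close>. Deleting from \<open>W\<close> all neighbours
  of \<open>k\<close> and \<open>j\<close> makes the exponential independent of the product, and the deletion changes
  the exponential by at most \<open>\<bar>t\<bar>\<close> times the sum of the absolute values of the deleted variables. The deletion is done
  once under the joint expectation and once, to restore \<open>cf t\<close>, under the separate one. As the
  exponential is Lipschitz, third moments suffice here; the usual treatment, through the variance
  of the sum of the products \<open>X k * X j\<close>, needs fourth moments.
\<close>
lemma pair_error:
  assumes kj: "k \<in> V" "j \<in> V"
  shows "cmod ((CLINT \<omega>|M. complex_of_real (X k \<omega> * X j \<omega>) * iexp (t * W \<omega>))
      - complex_of_real (expectation (\<lambda>\<omega>. X k \<omega> * X j \<omega>)) * cf t)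
    \<le> 2 * \<bar>t\<bar> * (\<Sum>l\<in>nb k \<union> nb j. (m3 k + m3 j + m3 l) / 3)"
proof -
  define N where "N = nb k \<union> nb j"
  have N: "N \<subseteq> V" "finite N" using kj nb_subset finite_V unfolding N_def by (auto intro: finite_subset)
  define e where "e \<omega> = iexp (t * W \<omega>)" for \<omega>
  \<comment> \<open>The exponential without the summands near \<open>k\<close> or \<open>j\<close>.\<close>
  define d where "d \<omega> = iexp (t * (\<Sum>i\<in>V - N. X i \<omega>))" for \<omega>
  define p where "p = expectation (\<lambda>\<omega>. X k \<omega> * X j \<omega>)"
  define s where "s = (\<Sum>l\<in>N. (m3 k + m3 j + m3 l) / 3)"
  have be: "bounded_rv M e" and bd: "bounded_rv M d"
    unfolding e_def d_def using bounded_rv_iexp_W bounded_rv_iexp_sum by auto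
  have bX: "i \<in> insert k (insert j N) \<Longrightarrow> bounded_rv M (X i)" for i
    using kj N bounded_rv_X by auto
  note b = be bd bounded_rv_intros bX insertI1 insertI2
  have diff: "cmod (e \<omega> - d \<omega>) \<le> \<bar>t\<bar> * (\<Sum>l\<in>N. \<bar>X l \<omega>\<bar>)" for \<omega>
  proof -
    have "W \<omega> - (\<Sum>i\<in>V - N. X i \<omega>) = (\<Sum>l\<in>N. X l \<omega>)"
      unfolding W_def using sum.subset_diff[OF N(1) finite_V, of "\<lambda>k. X k \<omega>"] by simp
    then have "t * W \<omega> - t * (\<Sum>i\<in>V - N. X i \<omega>) = t * (\<Sum>l\<in>N. X l \<omega>)"
      by (metis right_diff_distrib)
    then have "cmod (e \<omega> - d \<omega>) \<le> \<bar>t * (\<Sum>l\<in>N. X l \<omega>)\<bar>"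
      unfolding e_def d_def by (metis cmod_iexp_diff)
    also have "\<dots> \<le> \<bar>t\<bar> * (\<Sum>l\<in>N. \<bar>X l \<omega>\<bar>)"
      unfolding abs_mult by (intro mult_left_mono sum_abs) auto
    finally show ?thesis .
  qed
  have far: "(CLINT \<omega>|M. complex_of_real (X k \<omega> * X j \<omega>) * d \<omega>) = complex_of_real p * (CLINT \<omega>|M. d \<omega>)"
    using far_iexp[of "{k,j}" "V - N" "\<lambda>x. x k * x j" t] kj bounded_rv_mult[OF bX[of k] bX[of j]]
    unfolding d_def p_def N_def by simp
  have "(CLINT \<omega>|M. complex_of_real (X k \<omega> * X j \<omega>) * e \<omega>) - p * (CLINT \<omega>|M. e \<omega>)
    = ((CLINT \<omega>|M. complex_of_real (X k \<omega> * X j \<omega>) * e \<omega>) - (CLINT \<omega>|M. complex_of_real (X k \<omega> * X j \<omega>) * d \<omega>))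
      - p * ((CLINT \<omega>|M. e \<omega>) - (CLINT \<omega>|M. d \<omega>))"
    unfolding far by (simp add: algebra_simps)
  also have "(CLINT \<omega>|M. complex_of_real (X k \<omega> * X j \<omega>) * e \<omega>) - (CLINT \<omega>|M. complex_of_real (X k \<omega> * X j \<omega>) * d \<omega>)
     = (CLINT \<omega>|M. complex_of_real (X k \<omega> * X j \<omega>) * (e \<omega> - d \<omega>))"
    unfolding right_diff_distrib
    by (rule Bochner_Integration.integral_diff[symmetric]; intro integrable_bounded_rv b)
  also have "(CLINT \<omega>|M. e \<omega>) - (CLINT \<omega>|M. d \<omega>) = (CLINT \<omega>|M. e \<omega> - d \<omega>)"
    by (rule Bochner_Integration.integral_diff[symmetric]; intro integrable_bounded_rv b)
  finally have split: "(CLINT \<omega>|M. complex_of_real (X k \<omega> * X j \<omega>) * e \<omega>) - p * (CLINT \<omega>|M. e \<omega>)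
    = (CLINT \<omega>|M. complex_of_real (X k \<omega> * X j \<omega>) * (e \<omega> - d \<omega>)) - p * (CLINT \<omega>|M. e \<omega> - d \<omega>)" .
  have "cmod (CLINT \<omega>|M. complex_of_real (X k \<omega> * X j \<omega>) * (e \<omega> - d \<omega>))
      \<le> expectation (\<lambda>\<omega>. \<bar>t\<bar> * (\<Sum>l\<in>N. \<bar>X k \<omega> * X j \<omega> * X l \<omega>\<bar>))"
  proof (rule cmod_expectation_le)
    show "cmod (complex_of_real (X k \<omega> * X j \<omega>) * (e \<omega> - d \<omega>)) \<le> \<bar>t\<bar> * (\<Sum>l\<in>N. \<bar>X k \<omega> * X j \<omega> * X l \<omega>\<bar>)" for \<omega>
      using mult_left_mono[OF diff, of "\<bar>X k \<omega> * X j \<omega>\<bar>" \<omega>]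
      by (simp add: norm_mult abs_mult sum_distrib_left mult_ac)
  qed (intro b; simp)+
  also have "\<dots> = \<bar>t\<bar> * (\<Sum>l\<in>N. expectation (\<lambda>\<omega>. \<bar>X k \<omega> * X j \<omega> * X l \<omega>\<bar>))"
    by (subst integral_mult_right_zero, subst Bochner_Integration.integral_sum,
      intro integrable_bounded_rv b) simp_all
  also have "\<dots> \<le> \<bar>t\<bar> * s"
    unfolding s_def using N kj by (intro mult_left_mono sum_mono expectation_triple_le) auto
  finally have 1: "cmod (CLINT \<omega>|M. complex_of_real (X k \<omega> * X j \<omega>) * (e \<omega> - d \<omega>)) \<le> \<bar>t\<bar> * s" .
  have "cmod (CLINT \<omega>|M. e \<omega> - d \<omega>) \<le> expectation (\<lambda>\<omega>. \<bar>t\<bar> * (\<Sum>l\<in>N. \<bar>X l \<omega>\<bar>))"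
    by (rule cmod_expectation_le[OF _ _ diff]; intro b; simp)
  also have "\<dots> = \<bar>t\<bar> * (\<Sum>l\<in>N. expectation (\<lambda>\<omega>. \<bar>X l \<omega>\<bar>))"
    by (subst integral_mult_right_zero, subst Bochner_Integration.integral_sum,
      intro integrable_bounded_rv b) simp_all
  finally have "cmod (CLINT \<omega>|M. e \<omega> - d \<omega>) \<le> \<bar>t\<bar> * (\<Sum>l\<in>N. expectation (\<lambda>\<omega>. \<bar>X l \<omega>\<bar>))" .
  moreover have "\<bar>p\<bar> \<le> expectation (\<lambda>\<omega>. \<bar>X k \<omega> * X j \<omega>\<bar>)"
    unfolding p_def by (rule integral_abs_bound)
  ultimately have "cmod (p * (CLINT \<omega>|M. e \<omega> - d \<omega>))
     \<le> expectation (\<lambda>\<omega>. \<bar>X k \<omega> * X j \<omega>\<bar>) * (\<bar>t\<bar> * (\<Sum>l\<in>N. expectation (\<lambda>\<omega>. \<bar>X l \<omega>\<bar>)))"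
    unfolding norm_mult by (intro mult_mono) auto
  also have "\<dots> = \<bar>t\<bar> * (\<Sum>l\<in>N. expectation (\<lambda>\<omega>. \<bar>X k \<omega> * X j \<omega>\<bar>) * expectation (\<lambda>\<omega>. \<bar>X l \<omega>\<bar>))"
    by (simp add: sum_distrib_left mult.left_commute)
  also have "\<dots> \<le> \<bar>t\<bar> * s"
    unfolding s_def using N kj by (intro mult_left_mono sum_mono expectation_split_triple_le) auto
  finally have 2: "cmod (p * (CLINT \<omega>|M. e \<omega> - d \<omega>)) \<le> \<bar>t\<bar> * s" .
  have "cmod ((CLINT \<omega>|M. complex_of_real (X k \<omega> * X j \<omega>) * e \<omega>) - p * (CLINT \<omega>|M. e \<omega>)) \<le> 2 * \<bar>t\<bar> * s"
    unfolding split using order_trans[OF norm_triangle_ineq4 add_mono[OF 1 2]] by (simp add: mult_ac)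
  then show ?thesis unfolding cf_def e_def p_def s_def N_def .
qed

text \<open>
  Deleting the neighbours of \<open>k\<close> from \<open>W\<close> makes the exponential independent of the centred
  variable \<open>X k\<close>, so this part has expectation zero. What remains is the first-order
  term of the deletion, with the products over the neighbours of \<open>k\<close>, and a quadratic remainder.
\<close>
lemma single_error:
  assumes k: "k \<in> V"
  shows "cmod ((CLINT \<omega>|M. complex_of_real (X k \<omega>) * iexp (t * W \<omega>))
      - \<i> * t * (\<Sum>j\<in>nb k. CLINT \<omega>|M. complex_of_real (X k \<omega> * X j \<omega>) * iexp (t * W \<omega>)))
    \<le> t\<^sup>2 / 2 * (\<Sum>j\<in>nb k. \<Sum>l\<in>nb k. (m3 k + m3 j + m3 l) / 3)"
proof -
  have N: "nb k \<subseteq> V" "finite (nb k)" using k nb_subset finite_nb by auto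
  define U where "U \<omega> = (\<Sum>j\<in>nb k. X j \<omega>)" for \<omega>
  define e where "e \<omega> = iexp (t * W \<omega>)" for \<omega>
  \<comment> \<open>The exponential without the summands near \<open>k\<close>.\<close>
  define d where "d \<omega> = iexp (t * (\<Sum>i\<in>V - nb k. X i \<omega>))" for \<omega>
  have be: "bounded_rv M e" and bd: "bounded_rv M d" and bU: "bounded_rv M U"
    unfolding e_def d_def U_def using bounded_rv_iexp_W bounded_rv_iexp_sum bounded_rv_sum_X[OF N(1)] by auto
  have bX: "i \<in> insert k (nb k) \<Longrightarrow> bounded_rv M (X i)" for i
    using k N bounded_rv_X by auto
  note b = be bd bU bounded_rv_intros bX insertI1 insertI2
  have "t * (\<Sum>i\<in>V - nb k. X i \<omega>) = t * W \<omega> - t * U \<omega>" for \<omega>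
    unfolding W_def U_def using sum.subset_diff[OF N(1) finite_V, of "\<lambda>k. X k \<omega>"]
    by (simp add: algebra_simps)
  then have diff: "cmod (e \<omega> - d \<omega> - \<i> * t * U \<omega> * e \<omega>) \<le> t\<^sup>2 / 2 * (U \<omega>)\<^sup>2" for \<omega>
    using cmod_iexp_remainder[of "t * W \<omega>" "t * U \<omega>"] unfolding e_def d_def
    by (simp add: power_mult_distrib mult.assoc)
  have far: "(CLINT \<omega>|M. complex_of_real (X k \<omega>) * d \<omega>) = 0"
    using far_iexp[of "{k}" "V - nb k" "\<lambda>x. x k" t] k bX[of k] centred_X[OF k]
    unfolding d_def by simp
  have "(\<Sum>j\<in>nb k. CLINT \<omega>|M. complex_of_real (X k \<omega> * X j \<omega>) * e \<omega>)
     = (CLINT \<omega>|M. (\<Sum>j\<in>nb k. complex_of_real (X k \<omega> * X j \<omega>) * e \<omega>))"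
    by (rule Bochner_Integration.integral_sum[symmetric]; intro integrable_bounded_rv b; simp)
  also have "\<dots> = (CLINT \<omega>|M. complex_of_real (X k \<omega> * U \<omega>) * e \<omega>)"
    unfolding U_def by (simp add: sum_distrib_left sum_distrib_right)
  finally have "(CLINT \<omega>|M. complex_of_real (X k \<omega>) * e \<omega>)
      - \<i> * t * (\<Sum>j\<in>nb k. CLINT \<omega>|M. complex_of_real (X k \<omega> * X j \<omega>) * e \<omega>)
    = (CLINT \<omega>|M. complex_of_real (X k \<omega>) * e \<omega>) - (CLINT \<omega>|M. complex_of_real (X k \<omega>) * d \<omega>)
      - (CLINT \<omega>|M. \<i> * t * (complex_of_real (X k \<omega> * U \<omega>) * e \<omega>))"
    unfolding far by simp
  also have "\<dots> = (CLINT \<omega>|M. complex_of_real (X k \<omega>) * e \<omega> - complex_of_real (X k \<omega>) * d \<omega>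
      - \<i> * t * (complex_of_real (X k \<omega> * U \<omega>) * e \<omega>))"
    by (subst Bochner_Integration.integral_diff Bochner_Integration.integral_diff, (intro integrable_bounded_rv b; simp)+)+ simp
  also have "\<dots> = (CLINT \<omega>|M. complex_of_real (X k \<omega>) * (e \<omega> - d \<omega> - \<i> * t * U \<omega> * e \<omega>))"
    by (simp add: algebra_simps)
  also have "cmod \<dots> \<le> expectation (\<lambda>\<omega>. t\<^sup>2 / 2 * (\<Sum>j\<in>nb k. \<Sum>l\<in>nb k. \<bar>X k \<omega> * X j \<omega> * X l \<omega>\<bar>))"
  proof (rule cmod_expectation_le)
    fix \<omega>
    have "(U \<omega>)\<^sup>2 = (\<Sum>j\<in>nb k. \<Sum>l\<in>nb k. X j \<omega> * X l \<omega>)"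
      unfolding U_def power2_eq_square sum_product ..
    also have "\<dots> \<le> (\<Sum>j\<in>nb k. \<Sum>l\<in>nb k. \<bar>X j \<omega> * X l \<omega>\<bar>)"
      by (intro sum_mono abs_ge_self)
    finally have "cmod (e \<omega> - d \<omega> - \<i> * t * U \<omega> * e \<omega>) \<le> t\<^sup>2 / 2 * (\<Sum>j\<in>nb k. \<Sum>l\<in>nb k. \<bar>X j \<omega> * X l \<omega>\<bar>)"
      by (intro order_trans[OF diff] mult_left_mono) auto
    from mult_left_mono[OF this, of "\<bar>X k \<omega>\<bar>"]
    show "cmod (complex_of_real (X k \<omega>) * (e \<omega> - d \<omega> - \<i> * t * U \<omega> * e \<omega>))
        \<le> t\<^sup>2 / 2 * (\<Sum>j\<in>nb k. \<Sum>l\<in>nb k. \<bar>X k \<omega> * X j \<omega> * X l \<omega>\<bar>)"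
      by (simp add: norm_mult abs_mult sum_distrib_left mult_ac)
  qed (intro b; simp)+
  also have "\<dots> = t\<^sup>2 / 2 * (\<Sum>j\<in>nb k. \<Sum>l\<in>nb k. expectation (\<lambda>\<omega>. \<bar>X k \<omega> * X j \<omega> * X l \<omega>\<bar>))"
  proof -
    have "integrable M (\<lambda>\<omega>. \<bar>X k \<omega> * X j \<omega> * X l \<omega>\<bar>)" if "j \<in> nb k" "l \<in> nb k" for j l
      using that by (intro integrable_bounded_rv b)
    then show ?thesis
      by (simp add: Bochner_Integration.integral_sum Bochner_Integration.integrable_sum)
  qed
  also have "\<dots> \<le> t\<^sup>2 / 2 * (\<Sum>j\<in>nb k. \<Sum>l\<in>nb k. (m3 k + m3 j + m3 l) / 3)"
    using N k by (intro mult_left_mono sum_mono expectation_triple_le) auto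
  finally show ?thesis unfolding e_def .
qed

lemma second_moment_W:
  "expectation (\<lambda>\<omega>. (W \<omega>)\<^sup>2) = (\<Sum>k\<in>V. \<Sum>j\<in>nb k. expectation (\<lambda>\<omega>. X k \<omega> * X j \<omega>))"
  unfolding W_def using centred_X
  by (intro second_moment_sum(2)) (auto intro!: integrable_bounded_rv bounded_rv_intros bounded_rv_X)

text \<open>
  The first term is the derivative of \<open>cf\<close> at \<open>t\<close>. For a centred normal variable with variance
  \<open>s\<close> the characteristic function solves \<open>\<phi>' = - s * t * \<phi>\<close>; here the equation holds up to an
  error in third moments.
\<close>
lemma stein_identity_error:
  "cmod ((CLINT \<omega>|M. \<i> * W \<omega> * iexp (t * W \<omega>)) + t * expectation (\<lambda>\<omega>. (W \<omega>)\<^sup>2) * cf t)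
    \<le> 5 * t\<^sup>2 * B\<^sup>2 * (\<Sum>k\<in>V. m3 k)"
proof -
  define I where "I k = (CLINT \<omega>|M. complex_of_real (X k \<omega>) * iexp (t * W \<omega>))" for k
  define J where "J k j = (CLINT \<omega>|M. complex_of_real (X k \<omega> * X j \<omega>) * iexp (t * W \<omega>))" for k j
  define p where "p k j = expectation (\<lambda>\<omega>. X k \<omega> * X j \<omega>)" for k j
  define h where "h k j l = (m3 k + m3 j + m3 l) / 3" for k j l
  have h: "0 \<le> h k j l" for k j l unfolding h_def using m3_nonneg by (intro divide_nonneg_nonneg add_nonneg_nonneg) auto
  have in_V: "j \<in> V" if "k \<in> V" "j \<in> nb k" for k j using that nb_subset by blast
  have "(CLINT \<omega>|M. \<i> * W \<omega> * iexp (t * W \<omega>)) = (CLINT \<omega>|M. \<i> * (\<Sum>k\<in>V. complex_of_real (X k \<omega>) * iexp (t * W \<omega>)))"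
    unfolding W_def by (simp add: sum_distrib_right sum_distrib_left mult.assoc)
  also have "\<dots> = \<i> * (\<Sum>k\<in>V. I k)"
    unfolding I_def
    by (subst integral_mult_right_zero, subst Bochner_Integration.integral_sum,
      intro integrable_bounded_rv bounded_rv_mult bounded_rv_complex bounded_rv_X bounded_rv_iexp_W) simp_all
  finally have "(CLINT \<omega>|M. \<i> * W \<omega> * iexp (t * W \<omega>)) + t * expectation (\<lambda>\<omega>. (W \<omega>)\<^sup>2) * cf t
     = (\<Sum>k\<in>V. \<i> * I k + t * (\<Sum>j\<in>nb k. p k j * cf t))"
    unfolding second_moment_W p_def by (simp add: sum.distrib sum_distrib_left sum_distrib_right mult.assoc)
  also have "\<dots> = (\<Sum>k\<in>V. \<i> * (I k - \<i> * t * (\<Sum>j\<in>nb k. J k j)) - t * (\<Sum>j\<in>nb k. J k j - p k j * cf t))"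
    by (intro sum.cong refl) (simp add: sum_subtractf algebra_simps)
  also have "cmod \<dots> \<le> (\<Sum>k\<in>V. \<Sum>j\<in>nb k. 5 / 2 * t\<^sup>2 * (\<Sum>l\<in>nb k \<union> nb j. h k j l))"
  proof (rule sum_norm_le)
    fix k assume k: "k \<in> V"
    have "cmod (\<i> * (I k - \<i> * t * (\<Sum>j\<in>nb k. J k j))) \<le> t\<^sup>2 / 2 * (\<Sum>j\<in>nb k. \<Sum>l\<in>nb k. h k j l)"
      using single_error[OF k, of t] unfolding I_def J_def h_def norm_mult by simp
    also have "\<dots> \<le> t\<^sup>2 / 2 * (\<Sum>j\<in>nb k. \<Sum>l\<in>nb k \<union> nb j. h k j l)"
      using h finite_nb in_V k by (intro mult_left_mono sum_mono sum_mono2) auto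
    finally have 1: "cmod (\<i> * (I k - \<i> * t * (\<Sum>j\<in>nb k. J k j))) \<le> \<dots>" .
    have "cmod (\<Sum>j\<in>nb k. J k j - p k j * cf t) \<le> (\<Sum>j\<in>nb k. 2 * \<bar>t\<bar> * (\<Sum>l\<in>nb k \<union> nb j. h k j l))"
      unfolding J_def p_def h_def using k in_V by (intro sum_norm_le pair_error) auto
    then have "cmod (t * (\<Sum>j\<in>nb k. J k j - p k j * cf t)) \<le> \<bar>t\<bar> * (\<Sum>j\<in>nb k. 2 * \<bar>t\<bar> * (\<Sum>l\<in>nb k \<union> nb j. h k j l))"
      unfolding norm_mult by (auto intro: mult_left_mono)
    also have "\<dots> = 2 * t\<^sup>2 * (\<Sum>j\<in>nb k. \<Sum>l\<in>nb k \<union> nb j. h k j l)"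
      by (simp add: power2_eq_square flip: sum_distrib_left abs_mult)
    finally have 2: "cmod (t * (\<Sum>j\<in>nb k. J k j - p k j * cf t)) \<le> \<dots>" .
    show "cmod (\<i> * (I k - \<i> * t * (\<Sum>j\<in>nb k. J k j)) - t * (\<Sum>j\<in>nb k. J k j - p k j * cf t))
        \<le> (\<Sum>j\<in>nb k. 5 / 2 * t\<^sup>2 * (\<Sum>l\<in>nb k \<union> nb j. h k j l))"
      using order_trans[OF norm_triangle_ineq4 add_mono[OF 1 2]]
      unfolding sum_distrib_left[symmetric] by (simp add: algebra_simps)
  qed
  also have "\<dots> = 5 / 2 * t\<^sup>2 * (\<Sum>k\<in>V. \<Sum>j\<in>nb k. \<Sum>l\<in>nb k \<union> nb j. h k j l)"
    by (simp only: sum_distrib_left)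
  also have "\<dots> \<le> 5 / 2 * t\<^sup>2 * (2 * B\<^sup>2 * (\<Sum>k\<in>V. m3 k))"
    unfolding h_def using m3_nonneg by (intro mult_left_mono nb_triple_sum_le) auto
  finally show ?thesis by (simp only: mult_ac)
qed

end

context bounded_dependency_neighbourhoods
begin

lemma cf_has_vector_derivative:
  "(cf has_vector_derivative (CLINT \<omega>|M. \<i> * W \<omega> * iexp (t * W \<omega>))) (at t)"
proof -
  let ?e = "\<lambda>t \<omega>. iexp (t * W \<omega>)"
  note b = bounded_rv_intros bounded_rv_iexp_W bounded_rv_W
  have bound: "cmod (cf (t + h) - cf t - h *\<^sub>R (CLINT \<omega>|M. \<i> * W \<omega> * ?e t \<omega>))
      \<le> h\<^sup>2 * (expectation (\<lambda>\<omega>. (W \<omega>)\<^sup>2) / 2)" for h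
  proof -
    have "cf (t + h) - cf t - h *\<^sub>R (CLINT \<omega>|M. \<i> * W \<omega> * ?e t \<omega>)
        = cf (t + h) - cf t - (CLINT \<omega>|M. h * (\<i> * W \<omega> * ?e t \<omega>))"
      by (simp add: scaleR_conv_of_real)
    also have "\<dots> = (CLINT \<omega>|M. ?e (t + h) \<omega> - ?e t \<omega> - h * (\<i> * W \<omega> * ?e t \<omega>))"
      unfolding cf_def
      by (subst Bochner_Integration.integral_diff Bochner_Integration.integral_diff,
          (intro integrable_bounded_rv b bounded_rv_diff)+)+ simp
    also have "cmod \<dots> \<le> expectation (\<lambda>\<omega>. h\<^sup>2 / 2 * (W \<omega>)\<^sup>2)"
    proof (rule cmod_expectation_le)
      fix \<omega>
      show "cmod (?e (t + h) \<omega> - ?e t \<omega> - h * (\<i> * W \<omega> * ?e t \<omega>)) \<le> h\<^sup>2 / 2 * (W \<omega>)\<^sup>2"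
        using cmod_iexp_remainder[of "t * W \<omega>" "- (h * W \<omega>)"]
        by (simp add: norm_minus_commute algebra_simps power_mult_distrib)
    qed (intro b)+
    finally show ?thesis by simp
  qed
  have "((\<lambda>h. norm (cf (t + h) - cf t - h *\<^sub>R (CLINT \<omega>|M. \<i> * W \<omega> * ?e t \<omega>)) / norm h) \<longlongrightarrow> 0) (at 0)"
  proof (rule Lim_null_comparison)
    let ?K = "expectation (\<lambda>\<omega>. (W \<omega>)\<^sup>2) / 2"
    show "\<forall>\<^sub>F h in at 0. norm (norm (cf (t + h) - cf t - h *\<^sub>R (CLINT \<omega>|M. \<i> * W \<omega> * ?e t \<omega>)) / norm h) \<le> \<bar>h\<bar> * ?K"
    proof (rule always_eventually, rule allI)
      fix h :: real
      have "norm (cf (t + h) - cf t - h *\<^sub>R (CLINT \<omega>|M. \<i> * W \<omega> * ?e t \<omega>)) \<le> \<bar>h\<bar> * ?K * \<bar>h\<bar>"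
        using bound[of h] by (simp add: power2_eq_square mult_ac flip: abs_mult)
      then show "norm (norm (cf (t + h) - cf t - h *\<^sub>R (CLINT \<omega>|M. \<i> * W \<omega> * ?e t \<omega>)) / norm h) \<le> \<bar>h\<bar> * ?K"
        by (cases "h = 0") (auto simp: divide_le_eq)
    qed
    have "((\<lambda>h. \<bar>h\<bar> * ?K) \<longlongrightarrow> \<bar>0\<bar> * ?K) (at (0::real))" by (intro tendsto_intros)
    then show "((\<lambda>h. \<bar>h\<bar> * ?K) \<longlongrightarrow> 0) (at (0::real))" by simp
  qed
  then show ?thesis
    unfolding has_vector_derivative_def has_derivative_at using bounded_linear_scaleR_left by simp
qed

text \<open>
  Multiplying \<open>cf\<close> by the reciprocal of the Gaussian characteristic function turns the
  approximate differential equation into a bound on a derivative, and the mean value inequality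
  applies on the interval between \<open>-\<bar>t\<bar>\<close> and \<open>\<bar>t\<bar>\<close>.
\<close>
lemma cf_normal_approximation:
  assumes s: "s = expectation (\<lambda>\<omega>. (W \<omega>)\<^sup>2)"
  shows "cmod (cf t - exp (- (s * t\<^sup>2 / 2))) \<le> 5 * \<bar>t\<bar> ^ 3 * B\<^sup>2 * (\<Sum>k\<in>V. m3 k)"
proof -
  define D where "D u = (CLINT \<omega>|M. \<i> * W \<omega> * iexp (u * W \<omega>))" for u
  \<comment> \<open>The reciprocal of the Gaussian characteristic function with variance \<open>s\<close>.\<close>
  define E where "E u = exp (s * u\<^sup>2 / 2)" for u
  define g where "g u = cf u * complex_of_real (E u)" for u
  define K where "K = 5 * B\<^sup>2 * (\<Sum>k\<in>V. m3 k)"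
  have K: "0 \<le> K" unfolding K_def using m3_nonneg by (simp add: sum_nonneg)
  have s0: "0 \<le> s" unfolding s by (rule Bochner_Integration.integral_nonneg) simp
  have E: "(E has_real_derivative s * u * E u) (at u)" for u
  proof -
    have "((\<lambda>u. exp (s * u\<^sup>2 / 2)) has_real_derivative s * u * exp (s * u\<^sup>2 / 2)) (at u)"
      by (auto intro!: derivative_eq_intros)
    moreover have "E = (\<lambda>u. exp (s * u\<^sup>2 / 2))" by (simp add: E_def fun_eq_iff)
    ultimately show ?thesis by simp
  qed
  have g: "(g has_vector_derivative (D u + u * s * cf u) * E u) (at u)" for u
  proof -
    have "(g has_vector_derivative cf u * complex_of_real (s * u * E u) + D u * complex_of_real (E u)) (at u)"
      unfolding g_def D_def
      by (intro has_vector_derivative_mult cf_has_vector_derivative has_vector_derivative_of_real E)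
    then show ?thesis by (simp add: algebra_simps)
  qed
  have g': "cmod ((D u + u * s * cf u) * E u) \<le> K * t\<^sup>2 * E t" if u: "\<bar>u\<bar> \<le> \<bar>t\<bar>" for u
  proof -
    have ut: "u\<^sup>2 \<le> t\<^sup>2" using u by (simp add: abs_le_square_iff)
    have "cmod (D u + u * s * cf u) \<le> K * u\<^sup>2"
      using stein_identity_error[of u] unfolding D_def K_def s by (simp add: mult_ac)
    also have "\<dots> \<le> K * t\<^sup>2" using K ut by (rule mult_left_mono[rotated])
    finally have "cmod (D u + u * s * cf u) \<le> K * t\<^sup>2" .
    moreover have "E u \<le> E t" using ut s0 unfolding E_def by (simp add: mult_left_mono)
    ultimately show ?thesis
      unfolding norm_mult using K by (intro mult_mono) (auto simp: E_def)
  qed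
  have "cmod (g t - g 0) \<le> K * t\<^sup>2 * E t * norm (t - 0)"
  proof (rule differentiable_bound[where S = "{-\<bar>t\<bar>..\<bar>t\<bar>}" and f' = "\<lambda>u h. h *\<^sub>R ((D u + u * s * cf u) * E u)"])
    fix u assume "u \<in> {-\<bar>t\<bar>..\<bar>t\<bar>}"
    then have u: "\<bar>u\<bar> \<le> \<bar>t\<bar>" by auto
    show "(g has_derivative (\<lambda>h. h *\<^sub>R ((D u + u * s * cf u) * E u))) (at u within {-\<bar>t\<bar>..\<bar>t\<bar>})"
      using g[of u] unfolding has_vector_derivative_def by (rule has_derivative_at_withinI)
    show "onorm (\<lambda>h. h *\<^sub>R ((D u + u * s * cf u) * E u)) \<le> K * t\<^sup>2 * E t"
      by (rule onorm_le)
        (simp only: norm_scaleR real_norm_def mult.commute[of "\<bar>_\<bar>" "cmod _"] mult_right_mono[OF g'[OF u] abs_ge_zero])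
  qed auto
  moreover have "g 0 = 1" unfolding g_def cf_def E_def by (simp add: prob_space)
  ultimately have "cmod (g t - 1) \<le> K * \<bar>t\<bar> ^ 3 * E t"
    by (simp add: power2_eq_square power3_eq_cube abs_mult_self_eq mult_ac flip: abs_mult)
  moreover have "cf t - exp (- (s * t\<^sup>2 / 2)) = (g t - 1) * exp (- (s * t\<^sup>2 / 2))"
    unfolding g_def E_def by (simp add: algebra_simps exp_minus flip: of_real_mult)
  ultimately have "cmod (cf t - exp (- (s * t\<^sup>2 / 2))) \<le> K * \<bar>t\<bar> ^ 3 * E t * exp (- (s * t\<^sup>2 / 2))"
    by (simp only: norm_mult) (simp add: mult_right_mono)
  also have "\<dots> = K * \<bar>t\<bar> ^ 3" unfolding E_def by (simp add: exp_minus)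
  finally show ?thesis unfolding K_def by (simp add: mult_ac)
qed

end

section \<open>Normal approximation by truncation\<close>

lemma abs_exp_minus_diff_le:
  fixes a b :: real
  assumes "0 \<le> a" "0 \<le> b"
  shows "\<bar>exp (- a) - exp (- b)\<bar> \<le> \<bar>a - b\<bar>"
proof -
  have *: "exp (- x) - exp (- y) \<le> y - x" if "0 \<le> x" "x \<le> y" for x y :: real
  proof -
    have e: "1 - exp (- (y - x)) \<le> y - x"
      using exp_ge_add_one_self[of "- (y - x)"] by linarith
    have "exp (- x) - exp (- y) = exp (- x) * (1 - exp (- (y - x)))"
      by (simp add: algebra_simps flip: exp_add)
    also have "\<dots> \<le> 1 * (y - x)"
      using that by (intro mult_mono e) auto
    finally show ?thesis by simp
  qed
  show ?thesis
    using *[of a b] *[of b a] assms by (cases "a \<le> b") auto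
qed

lemma abs_diff_cube_le: "\<bar>a - b :: real\<bar> ^ 3 \<le> 4 * (\<bar>a\<bar> ^ 3 + \<bar>b\<bar> ^ 3)"
proof -
  define x y where "x = \<bar>a\<bar>" and "y = \<bar>b\<bar>"
  have "4 * (x ^ 3 + y ^ 3) - (x + y) ^ 3 = 3 * (x + y) * (x - y)\<^sup>2"
    by (simp add: algebra_simps power2_eq_square power3_eq_cube)
  moreover have "\<dots> \<ge> 0" unfolding x_def y_def by simp
  moreover have "\<bar>a - b\<bar> ^ 3 \<le> (x + y) ^ 3"
    unfolding x_def y_def by (intro power_mono abs_triangle_ineq4) auto
  ultimately show ?thesis unfolding x_def y_def by linarith
qed

text \<open>
  With \<open>z\<close> the first absolute moment, the arithmetic-geometric mean inequality for the factors
  \<open>\<bar>f\<bar>\<close>, \<open>z\<close>, \<open>z\<close> integrates to \<open>z ^ 3 \<le> (q + 2 * z ^ 3) / 3\<close>, which is the instance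
  \<open>z ^ 3 \<le> q\<close> of Jensen's inequality.
\<close>
lemma (in prob_space) centred_third_moment_le:
  fixes f :: "'a \<Rightarrow> real"
  assumes f: "bounded_rv M f"
  shows "expectation (\<lambda>\<omega>. \<bar>f \<omega> - expectation f\<bar> ^ 3) \<le> 8 * expectation (\<lambda>\<omega>. \<bar>f \<omega>\<bar> ^ 3)"
proof -
  define z where "z = expectation (\<lambda>\<omega>. \<bar>f \<omega>\<bar>)"
  define q where "q = expectation (\<lambda>\<omega>. \<bar>f \<omega>\<bar> ^ 3)"
  have z0: "0 \<le> z" unfolding z_def by (rule Bochner_Integration.integral_nonneg) simp
  have i1: "integrable M (\<lambda>\<omega>. \<bar>f \<omega>\<bar>)" and i3: "integrable M (\<lambda>\<omega>. \<bar>f \<omega>\<bar> ^ 3)"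
    by (intro integrable_bounded_rv bounded_rv_intros f)+
  have "z * (z * z) = expectation (\<lambda>\<omega>. \<bar>f \<omega>\<bar> * (z * z))" unfolding z_def by simp
  also have "\<dots> \<le> expectation (\<lambda>\<omega>. (\<bar>f \<omega>\<bar> ^ 3 + z ^ 3 + z ^ 3) / 3)"
    using i1 i3 arith_geo_mean_3[OF abs_ge_zero z0 z0] by (intro integral_mono) (auto simp: mult.assoc)
  also have "\<dots> = (q + z ^ 3 + z ^ 3) / 3"
    using i3 by (simp add: q_def prob_space)
  finally have zq: "z ^ 3 \<le> q" by (simp add: power3_eq_cube)
  have "\<bar>expectation f\<bar> \<le> z" unfolding z_def by (rule integral_abs_bound)
  then have "\<bar>expectation f\<bar> ^ 3 \<le> q"
    using zq power_mono[of "\<bar>expectation f\<bar>" z 3] by linarith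
  then have "4 * (q + \<bar>expectation f\<bar> ^ 3) \<le> 8 * q" by simp
  have "expectation (\<lambda>\<omega>. \<bar>f \<omega> - expectation f\<bar> ^ 3)
      \<le> expectation (\<lambda>\<omega>. 4 * (\<bar>f \<omega>\<bar> ^ 3 + \<bar>expectation f\<bar> ^ 3))"
    by (intro integral_mono integrable_bounded_rv bounded_rv_intros f abs_diff_cube_le)
  also have "\<dots> = 4 * (q + \<bar>expectation f\<bar> ^ 3)"
    using i3 by (simp add: q_def prob_space)
  also have "\<dots> \<le> 8 * q" by fact
  finally show ?thesis unfolding q_def .
qed

lemma (in prob_space) second_moment_centred_le:
  fixes f :: "'a \<Rightarrow> real"
  assumes "f \<in> borel_measurable M" "integrable M (\<lambda>\<omega>. (f \<omega>)\<^sup>2)"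
  shows "integrable M (\<lambda>\<omega>. (f \<omega> - expectation f)\<^sup>2)" "variance f \<le> expectation (\<lambda>\<omega>. (f \<omega>)\<^sup>2)"
proof -
  have i: "integrable M f" using square_integrable_imp_integrable[OF assms] .
  then show "integrable M (\<lambda>\<omega>. (f \<omega> - expectation f)\<^sup>2)"
    using assms(2) by (simp add: power2_diff)
  show "variance f \<le> expectation (\<lambda>\<omega>. (f \<omega>)\<^sup>2)"
    using variance_eq[OF i assms(2)] by simp
qed

lemma abs_mult_le_weighted:
  fixes a b r :: real
  assumes "0 < r"
  shows "\<bar>a * b\<bar> \<le> (r * a\<^sup>2 + b\<^sup>2 / r) / 2"
proof -
  have "0 \<le> (r * \<bar>a\<bar> - \<bar>b\<bar>)\<^sup>2 / r" using assms by simp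
  also have "\<dots> = r * a\<^sup>2 + b\<^sup>2 / r - 2 * \<bar>a * b\<bar>"
    using assms by (simp add: power2_diff power_mult_distrib field_simps abs_mult power2_eq_square)
  finally show ?thesis by simp
qed

text \<open>
  A Cauchy-Schwarz inequality, with the arithmetic-geometric mean inequality weighted by
  \<open>\<rho>\<close>. The bound \<open>\<rho>\<^sup>2\<close> on the second moment of \<open>g\<close> may be strict, which permits \<open>\<rho> > 0\<close>
  even if \<open>g\<close> vanishes.
\<close>
lemma (in prob_space) expectation_mult_le_weighted:
  fixes f g :: "'a \<Rightarrow> real"
  assumes [measurable]: "f \<in> borel_measurable M" "g \<in> borel_measurable M"
    and f: "integrable M (\<lambda>\<omega>. (f \<omega>)\<^sup>2)" "expectation (\<lambda>\<omega>. (f \<omega>)\<^sup>2) \<le> 1"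
    and g: "integrable M (\<lambda>\<omega>. (g \<omega>)\<^sup>2)" "expectation (\<lambda>\<omega>. (g \<omega>)\<^sup>2) \<le> \<rho>\<^sup>2" and "0 < \<rho>"
  shows "integrable M (\<lambda>\<omega>. f \<omega> * g \<omega>)" "expectation (\<lambda>\<omega>. \<bar>f \<omega> * g \<omega>\<bar>) \<le> \<rho>"
proof -
  have b: "integrable M (\<lambda>\<omega>. (\<rho> * (f \<omega>)\<^sup>2 + (g \<omega>)\<^sup>2 / \<rho>) / 2)" using f g by simp
  show i: "integrable M (\<lambda>\<omega>. f \<omega> * g \<omega>)"
    by (rule Bochner_Integration.integrable_bound[OF b])
      (use abs_mult_le_weighted[OF \<open>0 < \<rho>\<close>] in \<open>auto intro!: AE_I2 intro: order_trans[OF _ abs_ge_self]\<close>)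
  have "expectation (\<lambda>\<omega>. \<bar>f \<omega> * g \<omega>\<bar>) \<le> expectation (\<lambda>\<omega>. (\<rho> * (f \<omega>)\<^sup>2 + (g \<omega>)\<^sup>2 / \<rho>) / 2)"
    using i b by (intro integral_mono abs_mult_le_weighted \<open>0 < \<rho>\<close>) auto
  also have "\<dots> = (\<rho> * expectation (\<lambda>\<omega>. (f \<omega>)\<^sup>2) + expectation (\<lambda>\<omega>. (g \<omega>)\<^sup>2) / \<rho>) / 2"
    using f g by simp
  also have "\<dots> \<le> (\<rho> * 1 + \<rho>\<^sup>2 / \<rho>) / 2"
    using f g \<open>0 < \<rho>\<close> by (intro divide_right_mono add_mono mult_left_mono) auto
  also have "\<dots> = \<rho>" using \<open>0 < \<rho>\<close> by (simp add: power2_eq_square)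
  finally show "expectation (\<lambda>\<omega>. \<bar>f \<omega> * g \<omega>\<bar>) \<le> \<rho>" .
qed

definition truncate :: "real \<Rightarrow> real \<Rightarrow> real" where
  "truncate T x = (if \<bar>x\<bar> \<le> T then x else 0)"

definition tail :: "real \<Rightarrow> real \<Rightarrow> real" where
  "tail T x = (if \<bar>x\<bar> \<le> T then 0 else x)"

lemma truncate_add_tail: "truncate T x + tail T x = x"
  by (simp add: truncate_def tail_def)

lemma measurable_truncate [measurable]: "truncate T \<in> borel_measurable borel"
  and measurable_tail [measurable]: "tail T \<in> borel_measurable borel"
  unfolding truncate_def[abs_def] tail_def[abs_def] by measurable

lemma abs_truncate_le: "0 \<le> T \<Longrightarrow> \<bar>truncate T x\<bar> \<le> T"
  by (simp add: truncate_def)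

lemma abs_tail_le: "\<bar>tail T x\<bar> \<le> \<bar>x\<bar>"
  by (simp add: tail_def)

text \<open>
  The standardized sum \<open>W\<close> splits into the centred truncated part \<open>W0\<close> and the centred tail
  part \<open>R0\<close>. The tail part is at most \<open>\<rho>\<close> in the \<open>L\<^sup>2\<close> norm; it changes the characteristic
  function by at most \<open>\<bar>t\<bar> * \<rho>\<close> (first term) and the variance, which is 1 for \<open>W\<close>, by at most
  \<open>2 * \<rho> + \<rho>\<^sup>2\<close> (second term). The truncated part is bounded and is compared with a normal
  variable of its own variance; centring and dividing by \<open>v\<close> multiplies third moments by at
  most \<open>8 / v ^ 3\<close>, which makes the constant 40 out of 5.
\<close>
lemma (in dependency_neighbourhoods) normal_approximation:
  assumes sq: "\<And>k. k \<in> V \<Longrightarrow> integrable M (\<lambda>\<omega>. (X k \<omega>)\<^sup>2)"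
    and v: "0 < v" "variance (\<lambda>\<omega>. \<Sum>k\<in>V. X k \<omega>) = v\<^sup>2"
    and T: "0 \<le> T"
    and \<rho>: "0 < \<rho>" "B / v\<^sup>2 * (\<Sum>k\<in>V. expectation (\<lambda>\<omega>. (tail T (X k \<omega>))\<^sup>2)) \<le> \<rho>\<^sup>2"
    and \<gamma>: "B\<^sup>2 / v ^ 3 * (\<Sum>k\<in>V. expectation (\<lambda>\<omega>. \<bar>truncate T (X k \<omega>)\<bar> ^ 3)) \<le> \<gamma>"
  shows "cmod ((CLINT \<omega>|M. iexp (t * (((\<Sum>k\<in>V. X k \<omega>) - expectation (\<lambda>\<omega>. \<Sum>k\<in>V. X k \<omega>)) / v)))
      - exp (- (t\<^sup>2 / 2)))
    \<le> \<bar>t\<bar> * \<rho> + t\<^sup>2 / 2 * (2 * \<rho> + \<rho>\<^sup>2) + 40 * \<bar>t\<bar> ^ 3 * \<gamma>"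
proof -
  let ?tr = "\<lambda>k \<omega>. truncate T (X k \<omega>)" and ?ta = "\<lambda>k \<omega>. tail T (X k \<omega>)"
  define \<mu> where "\<mu> k = expectation (?tr k)" for k
  define Z where "Z k \<omega> = (?tr k \<omega> - \<mu> k) / v" for k \<omega>
  define R where "R k \<omega> = (?ta k \<omega> - expectation (?ta k)) / v" for k \<omega>
  define S where "S \<omega> = (\<Sum>k\<in>V. X k \<omega>)" for \<omega>
  define W where "W \<omega> = (S \<omega> - expectation S) / v" for \<omega>
  define W0 where "W0 \<omega> = (\<Sum>k\<in>V. Z k \<omega>)" for \<omega>
  define R0 where "R0 \<omega> = (\<Sum>k\<in>V. R k \<omega>)" for \<omega>
  note rv_X [measurable]
  have btr: "bounded_rv M (?tr k)" if "k \<in> V" for k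
    using that abs_truncate_le[OF T] by (intro bounded_rvI[where K = T]) auto
  have itr: "integrable M (?tr k)" if "k \<in> V" for k
    using integrable_bounded_rv[OF btr[OF that]] .
  have mta: "?ta k \<in> borel_measurable M" if "k \<in> V" for k
    using that by measurable
  have sqta: "integrable M (\<lambda>\<omega>. (?ta k \<omega>)\<^sup>2)" if "k \<in> V" for k
    by (rule Bochner_Integration.integrable_bound[OF sq[OF that]])
      (use mta[OF that] abs_tail_le in \<open>auto intro!: AE_I2 simp flip: abs_le_square_iff\<close>)
  have ita: "integrable M (?ta k)" if "k \<in> V" for k
    using square_integrable_imp_integrable[OF mta[OF that] sqta[OF that]] .
  have mean: "\<bar>\<mu> k\<bar> \<le> T" if "k \<in> V" for k
  proof -
    have "\<bar>\<mu> k\<bar> \<le> expectation (\<lambda>\<omega>. \<bar>?tr k \<omega>\<bar>)" unfolding \<mu>_def by (rule integral_abs_bound)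
    also have "\<dots> \<le> expectation (\<lambda>\<omega>. T)"
      using itr[OF that] abs_truncate_le[OF T] by (intro integral_mono) auto
    finally show ?thesis by (simp add: prob_space)
  qed
  interpret D: dependency_neighbourhoods M V nb B Z
    unfolding Z_def using componentwise_transform[of "\<lambda>k x. (truncate T x - \<mu> k) / v"] by simp
  interpret Z: bounded_dependency_neighbourhoods M V nb B Z "2 * T / v"
  proof
    fix k \<omega> assume k: "k \<in> V"
    have "\<bar>?tr k \<omega> - \<mu> k\<bar> \<le> 2 * T"
      using mean[OF k] abs_truncate_le[OF T, of "X k \<omega>"] by linarith
    then show "\<bar>Z k \<omega>\<bar> \<le> 2 * T / v"
      unfolding Z_def using v by (simp add: abs_divide divide_right_mono)
    show "expectation (Z k) = 0"
      unfolding Z_def using itr[OF k] by (simp add: \<mu>_def prob_space)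
  qed
  interpret R: dependency_neighbourhoods M V nb B R
    unfolding R_def using componentwise_transform[of "\<lambda>k x. (tail T x - expectation (?ta k)) / v"] by simp

  have ER: "expectation (R k) = 0" if "k \<in> V" for k
    unfolding R_def using ita[OF that] by (simp add: prob_space)
  have sqR: "integrable M (\<lambda>\<omega>. (R k \<omega>)\<^sup>2)" if "k \<in> V" for k
    unfolding R_def power_divide using second_moment_centred_le(1)[OF mta[OF that] sqta[OF that]] by simp
  have ER2: "expectation (\<lambda>\<omega>. (R k \<omega>)\<^sup>2) \<le> expectation (\<lambda>\<omega>. (?ta k \<omega>)\<^sup>2) / v\<^sup>2" if "k \<in> V" for k
    unfolding R_def power_divide using second_moment_centred_le(2)[OF mta[OF that] sqta[OF that]] v
    by (simp add: divide_right_mono)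
  have sqR0: "integrable M (\<lambda>\<omega>. (R0 \<omega>)\<^sup>2)"
    unfolding R0_def using ER sqR by (rule R.second_moment_sum(1))
  have mR0 [measurable]: "R0 \<in> borel_measurable M"
    unfolding R0_def using R.rv_X by measurable
  have R0: "expectation (\<lambda>\<omega>. (R0 \<omega>)\<^sup>2) \<le> \<rho>\<^sup>2"
  proof (cases "V = {}")
    case False
    have "expectation (\<lambda>\<omega>. (R0 \<omega>)\<^sup>2) \<le> B * (\<Sum>k\<in>V. expectation (\<lambda>\<omega>. (R k \<omega>)\<^sup>2))"
      unfolding R0_def using ER sqR by (rule R.second_moment_sum(3))
    also have "\<dots> \<le> B * (\<Sum>k\<in>V. expectation (\<lambda>\<omega>. (?ta k \<omega>)\<^sup>2) / v\<^sup>2)"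
      using ER2 B_nonneg[OF False] by (intro mult_left_mono sum_mono)
    also have "\<dots> = B / v\<^sup>2 * (\<Sum>k\<in>V. expectation (\<lambda>\<omega>. (?ta k \<omega>)\<^sup>2))"
      by (simp flip: sum_divide_distrib)
    finally show ?thesis using \<rho> by linarith
  qed (simp add: R0_def)

  have iX: "integrable M (X k)" if "k \<in> V" for k
    using square_integrable_imp_integrable[OF rv_X[OF that] sq[OF that]] .
  have ES: "expectation S = (\<Sum>k\<in>V. \<mu> k + expectation (?ta k))"
  proof -
    have "expectation S = (\<Sum>k\<in>V. expectation (X k))"
      unfolding S_def using iX by (rule Bochner_Integration.integral_sum)
    also have "\<dots> = (\<Sum>k\<in>V. \<mu> k + expectation (?ta k))"
    proof (rule sum.cong[OF refl])
      fix k assume k: "k \<in> V"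
      have "expectation (X k) = expectation (\<lambda>\<omega>. ?tr k \<omega> + ?ta k \<omega>)" by (simp add: truncate_add_tail)
      also have "\<dots> = \<mu> k + expectation (?ta k)" using itr[OF k] ita[OF k] by (simp add: \<mu>_def)
      finally show "expectation (X k) = \<mu> k + expectation (?ta k)" .
    qed
    finally show ?thesis .
  qed
  have W: "W \<omega> = W0 \<omega> + R0 \<omega>" for \<omega>
  proof -
    have "S \<omega> = (\<Sum>k\<in>V. ?tr k \<omega> + ?ta k \<omega>)" unfolding S_def by (simp add: truncate_add_tail)
    then show ?thesis
      unfolding W_def W0_def R0_def Z_def R_def ES
      by (simp add: sum.distrib sum_subtractf diff_divide_distrib add_divide_distrib flip: sum_divide_distrib)
  qed
  have W0_eq: "W0 = Z.W" unfolding W0_def Z.W_def[abs_def] by (rule ext) simp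
  have mW0 [measurable]: "W0 \<in> borel_measurable M" unfolding W0_eq by (rule Z.measurable_W)
  have mW [measurable]: "W \<in> borel_measurable M" unfolding W by measurable
  have sqW0: "integrable M (\<lambda>\<omega>. (W0 \<omega>)\<^sup>2)"
    unfolding W0_eq by (intro integrable_bounded_rv bounded_rv_intros Z.bounded_rv_W)
  have EW2: "expectation (\<lambda>\<omega>. (W \<omega>)\<^sup>2) = 1"
    unfolding W_def power_divide using v unfolding S_def by simp
  then have sqW: "integrable M (\<lambda>\<omega>. (W \<omega>)\<^sup>2)"
    using not_integrable_integral_eq by fastforce
  define s where "s = expectation (\<lambda>\<omega>. (W0 \<omega>)\<^sup>2)"
  have s0: "0 \<le> s" unfolding s_def by (rule Bochner_Integration.integral_nonneg) simp
  have s1: "\<bar>s - 1\<bar> \<le> 2 * \<rho> + \<rho>\<^sup>2"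
  proof -
    note WR = expectation_mult_le_weighted[OF mW mR0 sqW _ sqR0 R0 \<rho>(1)]
    have "(W0 \<omega>)\<^sup>2 = (W \<omega>)\<^sup>2 - 2 * (W \<omega> * R0 \<omega>) + (R0 \<omega>)\<^sup>2" for \<omega>
      unfolding W by (simp add: power2_eq_square algebra_simps)
    then have "s = 1 - 2 * expectation (\<lambda>\<omega>. W \<omega> * R0 \<omega>) + expectation (\<lambda>\<omega>. (R0 \<omega>)\<^sup>2)"
      unfolding s_def using sqW sqR0 WR(1) EW2 by simp
    moreover have "\<bar>expectation (\<lambda>\<omega>. W \<omega> * R0 \<omega>)\<bar> \<le> \<rho>"
      using EW2 by (intro order_trans[OF integral_abs_bound WR(2)]) simp
    moreover have "0 \<le> expectation (\<lambda>\<omega>. (R0 \<omega>)\<^sup>2)" by (rule Bochner_Integration.integral_nonneg) simp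
    ultimately show ?thesis using R0 by linarith
  qed

  have 1: "cmod ((CLINT \<omega>|M. iexp (t * W \<omega>)) - Z.cf t) \<le> \<bar>t\<bar> * \<rho>"
  proof -
    have b: "bounded_rv M (\<lambda>\<omega>. iexp (t * W \<omega>))" "bounded_rv M (\<lambda>\<omega>. iexp (t * W0 \<omega>))"
      by (intro bounded_rv_iexp; measurable)+
    have iR: "integrable M (\<lambda>\<omega>. \<bar>R0 \<omega>\<bar>)" "expectation (\<lambda>\<omega>. \<bar>R0 \<omega>\<bar>) \<le> \<rho>"
      using expectation_mult_le_weighted[of "\<lambda>_. 1" R0 \<rho>] sqR0 R0 \<rho>(1) by (auto simp: prob_space)
    have "(CLINT \<omega>|M. iexp (t * W \<omega>)) - Z.cf t = (CLINT \<omega>|M. iexp (t * W \<omega>) - iexp (t * W0 \<omega>))"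
      unfolding Z.cf_def W0_eq[symmetric] using b by (simp add: integrable_bounded_rv)
    also have "cmod \<dots> \<le> expectation (\<lambda>\<omega>. cmod (iexp (t * W \<omega>) - iexp (t * W0 \<omega>)))"
      by (rule integral_norm_bound)
    also have "\<dots> \<le> expectation (\<lambda>\<omega>. \<bar>t\<bar> * \<bar>R0 \<omega>\<bar>)"
    proof (rule integral_mono)
      show "integrable M (\<lambda>\<omega>. cmod (iexp (t * W \<omega>) - iexp (t * W0 \<omega>)))"
        by (intro integrable_norm integrable_bounded_rv bounded_rv_diff b)
      show "cmod (iexp (t * W \<omega>) - iexp (t * W0 \<omega>)) \<le> \<bar>t\<bar> * \<bar>R0 \<omega>\<bar>" for \<omega>
        using cmod_iexp_diff[of "t * W \<omega>" "t * W0 \<omega>"]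
        unfolding W by (simp add: distrib_left abs_mult)
    qed (use iR in simp)
    also have "\<dots> \<le> \<bar>t\<bar> * \<rho>" using iR by (simp add: mult_left_mono)
    finally show ?thesis .
  qed
  have 2: "cmod (Z.cf t - exp (- (s * t\<^sup>2 / 2))) \<le> 40 * \<bar>t\<bar> ^ 3 * \<gamma>"
  proof -
    have "Z.m3 k \<le> 8 * expectation (\<lambda>\<omega>. \<bar>?tr k \<omega>\<bar> ^ 3) / v ^ 3" if "k \<in> V" for k
      unfolding Z.m3_def Z_def abs_divide power_divide \<mu>_def
      using centred_third_moment_le[OF btr[OF that]] v by (simp add: divide_right_mono)
    then have "(\<Sum>k\<in>V. Z.m3 k) \<le> (\<Sum>k\<in>V. 8 * expectation (\<lambda>\<omega>. \<bar>?tr k \<omega>\<bar> ^ 3) / v ^ 3)"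
      by (rule sum_mono)
    also have "\<dots> = 8 * (\<Sum>k\<in>V. expectation (\<lambda>\<omega>. \<bar>?tr k \<omega>\<bar> ^ 3)) / v ^ 3"
      by (simp only: sum_divide_distrib sum_distrib_left)
    finally have "B\<^sup>2 * (\<Sum>k\<in>V. Z.m3 k) \<le> B\<^sup>2 * (8 * (\<Sum>k\<in>V. expectation (\<lambda>\<omega>. \<bar>?tr k \<omega>\<bar> ^ 3)) / v ^ 3)"
      by (intro mult_left_mono) auto
    also have "\<dots> = 8 * (B\<^sup>2 / v ^ 3 * (\<Sum>k\<in>V. expectation (\<lambda>\<omega>. \<bar>?tr k \<omega>\<bar> ^ 3)))" by simp
    also have "\<dots> \<le> 8 * \<gamma>" using \<gamma> by simp
    finally have "5 * \<bar>t\<bar> ^ 3 * (B\<^sup>2 * (\<Sum>k\<in>V. Z.m3 k)) \<le> 5 * \<bar>t\<bar> ^ 3 * (8 * \<gamma>)"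
      by (intro mult_left_mono) auto
    then show ?thesis
      using Z.cf_normal_approximation[of s t] unfolding s_def W0_eq by (simp add: mult_ac)
  qed
  have 3: "cmod (complex_of_real (exp (- (s * t\<^sup>2 / 2))) - exp (- (t\<^sup>2 / 2))) \<le> t\<^sup>2 / 2 * (2 * \<rho> + \<rho>\<^sup>2)"
  proof -
    have "cmod (complex_of_real (exp (- (s * t\<^sup>2 / 2))) - exp (- (t\<^sup>2 / 2))) = \<bar>exp (- (s * t\<^sup>2 / 2)) - exp (- (t\<^sup>2 / 2))\<bar>"
      by (simp only: norm_of_real flip: of_real_diff)
    also have "\<dots> \<le> \<bar>s * t\<^sup>2 / 2 - t\<^sup>2 / 2\<bar>"
      using s0 by (intro abs_exp_minus_diff_le) auto
    also have "\<dots> = t\<^sup>2 / 2 * \<bar>s - 1\<bar>"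
    proof -
      have "s * t\<^sup>2 / 2 - t\<^sup>2 / 2 = t\<^sup>2 / 2 * (s - 1)" by (simp add: field_simps)
      then show ?thesis by (simp only: abs_mult) simp
    qed
    also have "\<dots> \<le> t\<^sup>2 / 2 * (2 * \<rho> + \<rho>\<^sup>2)" using s1 by (intro mult_left_mono) auto
    finally show ?thesis .
  qed
  have "(CLINT \<omega>|M. iexp (t * W \<omega>)) - exp (- (t\<^sup>2 / 2))
    = ((CLINT \<omega>|M. iexp (t * W \<omega>)) - Z.cf t) + ((complex_of_real (exp (- (s * t\<^sup>2 / 2))) - exp (- (t\<^sup>2 / 2)))
      + (Z.cf t - exp (- (s * t\<^sup>2 / 2))))" by simp
  also have "cmod \<dots> \<le> \<bar>t\<bar> * \<rho> + (t\<^sup>2 / 2 * (2 * \<rho> + \<rho>\<^sup>2) + 40 * \<bar>t\<bar> ^ 3 * \<gamma>)"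
    by (intro norm_triangle_mono 1 2 3)
  finally show ?thesis unfolding W_def S_def[abs_def] by (simp only: add.assoc)
qed

section \<open>From dependency graphs to neighbourhoods\<close>

lemma card_set_mset_le_size: "card (set_mset A) \<le> size A"
proof -
  have "card (set_mset A) = (\<Sum>x\<in>set_mset A. 1)" by simp
  also have "\<dots> \<le> (\<Sum>x\<in>set_mset A. count A x)"
    by (intro sum_mono) (simp add: Suc_le_eq)
  finally show ?thesis by (simp add: size_multiset_overloaded_eq)
qed

text \<open>
  Distinct neighbours of \<open>k\<close> other than \<open>k\<close> itself are joined to \<open>k\<close> by distinct edges, so a
  vertex has at most as many of them as its degree; multiple edges and loops only increase the
  degree.
\<close>
lemma dependency_graph_neighbourhoods:
  assumes M: "prob_space M" and dep: "dependency_graph M V Y G"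
    and Y: "\<And>k. k \<in> V \<Longrightarrow> Y k \<in> borel_measurable M"
  shows "dependency_neighbourhoods M V (\<lambda>k. {j \<in> V. j = k \<or> Upair k j \<in># G})
    (real (max_mdegree V G) + 1) Y"
proof -
  interpret prob_space M by fact
  let ?nb = "\<lambda>k. {j \<in> V. j = k \<or> Upair k j \<in># G}"
  have V: "finite V" using dep unfolding dependency_graph_def multigraph_on_def by auto
  have indep: "indep_var (PiM V1 (\<lambda>_. borel)) (\<lambda>\<omega>. \<lambda>k\<in>V1. Y k \<omega>) (PiM V2 (\<lambda>_. borel)) (\<lambda>\<omega>. \<lambda>k\<in>V2. Y k \<omega>)"
    if "V1 \<subseteq> V" "V2 \<subseteq> V" "V1 \<inter> V2 = {}" "\<not> (\<exists>e \<in># G. \<exists>x \<in> V1. \<exists>y \<in> V2. e = Upair x y)" for V1 V2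
    using dep that unfolding dependency_graph_def by blast
  show ?thesis
  proof
    show "finite V" by fact
    show "real (card (?nb k)) \<le> real (max_mdegree V G) + 1" if k: "k \<in> V" for k
    proof -
      let ?J = "{j \<in> V. j \<noteq> k \<and> Upair k j \<in># G}" and ?F = "{#e \<in># G. k \<in> set_uprod e#}"
      have "card ?J = card (Upair k ` ?J)"
        by (rule card_image[symmetric]) (auto simp: inj_on_def)
      also have "\<dots> \<le> card (set_mset ?F)"
        by (intro card_mono) auto
      also have "\<dots> \<le> mdegree G k"
        unfolding mdegree_def by (rule card_set_mset_le_size)
      also have "\<dots> \<le> max_mdegree V G"
        unfolding max_mdegree_def using V k by (intro Max_ge) auto
      finally have "card (insert k ?J) \<le> Suc (max_mdegree V G)"
        using V by (simp add: card_insert_if)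
      moreover have "?nb k = insert k ?J" using k by auto
      ultimately show ?thesis by simp
    qed
    show "k \<in> ?nb j" if "k \<in> V" "j \<in> ?nb k" for k j
    proof -
      have "Upair k j = Upair j k" by simp
      then have "Upair k j \<in># G \<longleftrightarrow> Upair j k \<in># G" by (rule arg_cong)
      then show ?thesis using that by blast
    qed
    show "indep_var (PiM A (\<lambda>_. borel)) (\<lambda>\<omega>. \<lambda>k\<in>A. Y k \<omega>)
       (PiM (V - \<Union>(?nb ` A)) (\<lambda>_. borel)) (\<lambda>\<omega>. \<lambda>k\<in>V - \<Union>(?nb ` A). Y k \<omega>)" if "A \<subseteq> V" for A
      using that by (intro indep) auto
  qed (use Y in auto)
qed

section \<open>Moments of truncated variables\<close>

lemma truncate_cube_le:
  fixes T x \<delta> :: real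
  assumes "0 < T" "\<delta> \<le> 3"
  shows "\<bar>truncate T x\<bar> ^ 3 \<le> T powr (3 - \<delta>) * \<bar>x\<bar> powr \<delta>"
proof (cases "x = 0 \<or> \<not> \<bar>x\<bar> \<le> T")
  case False
  then have x: "0 < \<bar>x\<bar>" "\<bar>x\<bar> \<le> T" by auto
  have "\<bar>x\<bar> ^ 3 = \<bar>x\<bar> powr (3 - \<delta>) * \<bar>x\<bar> powr \<delta>"
    using x powr_realpow[of "\<bar>x\<bar>" 3] by (simp flip: powr_add)
  also have "\<dots> \<le> T powr (3 - \<delta>) * \<bar>x\<bar> powr \<delta>"
    using x assms by (intro mult_right_mono powr_mono2) auto
  finally show ?thesis using x by (simp add: truncate_def)
qed (auto simp: truncate_def)

lemma tail_square_le:
  fixes T x \<delta> :: real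
  assumes "0 < T" "2 \<le> \<delta>"
  shows "(tail T x)\<^sup>2 \<le> T powr (2 - \<delta>) * \<bar>x\<bar> powr \<delta>"
proof (cases "\<bar>x\<bar> \<le> T")
  case False
  have "(tail T x)\<^sup>2 = \<bar>x\<bar> powr (2 - \<delta>) * \<bar>x\<bar> powr \<delta>"
    using False assms by (simp add: tail_def flip: powr_add)
  also have "\<dots> \<le> T powr (2 - \<delta>) * \<bar>x\<bar> powr \<delta>"
    using False assms by (intro mult_right_mono powr_mono2') auto
  finally show ?thesis .
qed (simp add: tail_def)

text \<open>
  The concave function \<open>y powr q\<close> lies below its tangent at \<open>a\<close>.
\<close>
lemma powr_tangent_le:
  fixes a y q :: real
  assumes "0 < a" "0 \<le> y" "0 \<le> q" "q \<le> 1"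
  shows "y powr q \<le> a powr q * (1 - q + q * (y / a))"
proof (cases "y = 0")
  case False
  then have "(y / a) powr q * 1 powr (1 - q) \<le> q * (y / a) + (1 - q) * 1"
    using assms by (intro Youngs_inequality_0) auto
  then have "a powr q * (y / a) powr q \<le> a powr q * (1 - q + q * (y / a))"
    by (intro mult_left_mono) auto
  then show ?thesis using assms False by (simp add: powr_divide)
qed (use assms in auto)

text \<open>
  Jensen's inequality for the concave power \<open>3 / \<delta>\<close> and the average over both the index and
  the sample space: the tangent at the averaged \<open>\<delta>\<close>-th moment \<open>a\<close> is the right one, because its
  linear part averages to the constant. If \<open>a = 0\<close> there is no tangent, but then all variables
  vanish almost surely.
\<close>
lemma (in prob_space) sum_third_moment_truncate_le:
  fixes X :: "nat \<Rightarrow> 'a \<Rightarrow> real"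
  assumes X: "\<And>k. k \<in> V \<Longrightarrow> X k \<in> borel_measurable M"
    and int: "\<And>k. k \<in> V \<Longrightarrow> integrable M (\<lambda>\<omega>. \<bar>X k \<omega>\<bar> powr \<delta>)"
    and \<delta>: "3 \<le> \<delta>" and V: "finite V" "V \<noteq> {}" and T: "0 \<le> T"
  defines "a \<equiv> (\<Sum>k\<in>V. expectation (\<lambda>\<omega>. \<bar>X k \<omega>\<bar> powr \<delta>)) / card V"
  shows "(\<Sum>k\<in>V. expectation (\<lambda>\<omega>. \<bar>truncate T (X k \<omega>)\<bar> ^ 3)) \<le> card V * a powr (3 / \<delta>)"
proof -
  let ?A = "\<lambda>k. expectation (\<lambda>\<omega>. \<bar>X k \<omega>\<bar> powr \<delta>)"
  have A0: "0 \<le> ?A k" for k by (rule Bochner_Integration.integral_nonneg) simp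
  have n: "0 < card V" using V by (simp add: card_gt_0_iff)
  have a0: "0 \<le> a" unfolding a_def using A0 by (simp add: sum_nonneg)
  have itr: "integrable M (\<lambda>\<omega>. \<bar>truncate T (X k \<omega>)\<bar> ^ 3)" if "k \<in> V" for k
    using X[OF that] abs_truncate_le[OF T]
    by (intro integrable_bounded_rv bounded_rv_intros bounded_rvI[where K = T]) auto
  show ?thesis
  proof (cases "a = 0")
    case True
    have "expectation (\<lambda>\<omega>. \<bar>truncate T (X k \<omega>)\<bar> ^ 3) = 0" if k: "k \<in> V" for k
    proof -
      have "(\<Sum>k\<in>V. ?A k) = 0" using True n unfolding a_def by simp
      then have "?A k = 0" using A0 V k by (simp add: sum_nonneg_eq_0_iff)
      then have "AE \<omega> in M. \<bar>X k \<omega>\<bar> powr \<delta> = 0"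
        using integral_nonneg_eq_0_iff_AE[OF int[OF k]] by simp
      then have "AE \<omega> in M. \<bar>truncate T (X k \<omega>)\<bar> ^ 3 = 0"
        by eventually_elim (simp add: truncate_def)
      then show ?thesis by (rule integral_eq_zero_AE)
    qed
    then show ?thesis by simp
  next
    case False
    then have a: "0 < a" using a0 by simp
    have "expectation (\<lambda>\<omega>. \<bar>truncate T (X k \<omega>)\<bar> ^ 3)
        \<le> expectation (\<lambda>\<omega>. a powr (3 / \<delta>) * (1 - 3 / \<delta> + 3 / \<delta> * (\<bar>X k \<omega>\<bar> powr \<delta> / a)))" if k: "k \<in> V" for k
    proof (rule integral_mono[OF itr[OF k]])
      show "integrable M (\<lambda>\<omega>. a powr (3 / \<delta>) * (1 - 3 / \<delta> + 3 / \<delta> * (\<bar>X k \<omega>\<bar> powr \<delta> / a)))"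
        using int[OF k] by simp
      fix \<omega>
      have "\<bar>truncate T (X k \<omega>)\<bar> ^ 3 \<le> \<bar>X k \<omega>\<bar> ^ 3"
        by (intro power_mono) (auto simp: truncate_def)
      also have "\<dots> = (\<bar>X k \<omega>\<bar> powr \<delta>) powr (3 / \<delta>)"
        using \<delta> powr_realpow'[of "\<bar>X k \<omega>\<bar>" 3] by (simp add: powr_powr)
      also have "\<dots> \<le> a powr (3 / \<delta>) * (1 - 3 / \<delta> + 3 / \<delta> * (\<bar>X k \<omega>\<bar> powr \<delta> / a))"
        using a \<delta> by (intro powr_tangent_le) auto
      finally show "\<bar>truncate T (X k \<omega>)\<bar> ^ 3 \<le> \<dots>" .
    qed
    then have "(\<Sum>k\<in>V. expectation (\<lambda>\<omega>. \<bar>truncate T (X k \<omega>)\<bar> ^ 3))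
       \<le> (\<Sum>k\<in>V. a powr (3 / \<delta>) * (1 - 3 / \<delta> + 3 / \<delta> * (?A k / a)))"
      using int by (intro sum_mono) (simp add: prob_space)
    also have "\<dots> = a powr (3 / \<delta>) * (card V * (1 - 3 / \<delta>) + 3 / \<delta> * ((\<Sum>k\<in>V. ?A k) / a))"
      by (simp only: sum.distrib sum_constant flip: sum_distrib_left sum_divide_distrib)
    also have "(\<Sum>k\<in>V. ?A k) / a = card V"
      using a n unfolding a_def by (auto simp: field_simps)
    also have "a powr (3 / \<delta>) * (card V * (1 - 3 / \<delta>) + 3 / \<delta> * card V) = card V * a powr (3 / \<delta>)"
      by (simp add: algebra_simps)
    finally show ?thesis .
  qed
qed

section \<open>A Lindeberg-type criterion\<close>

text \<open>
  A Lindeberg-type criterion: the two hypotheses say that the tails are negligible in \<open>L\<^sup>2\<close> and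
  that the truncated variables satisfy a Lyapunov condition of order three, each with the power
  of \<open>B\<close> that the dependencies cost.
\<close>
lemma char_fun_tendsto:
  fixes M :: "nat \<Rightarrow> 'a measure" and X :: "nat \<Rightarrow> nat \<Rightarrow> 'a \<Rightarrow> real" and B v T :: "nat \<Rightarrow> real"
  assumes dep: "\<And>N. 1 \<le> N \<Longrightarrow> dependency_neighbourhoods (M N) {1..N} (nb N) (B N) (X N)"
    and sq: "\<And>N k. 1 \<le> k \<Longrightarrow> k \<le> N \<Longrightarrow> integrable (M N) (\<lambda>\<omega>. (X N k \<omega>)\<^sup>2)"
    and v: "\<forall>\<^sub>F N in sequentially. 0 < v N \<and> 0 \<le> T N \<and>
       prob_space.variance (M N) (\<lambda>\<omega>. \<Sum>k=1..N. X N k \<omega>) = (v N)\<^sup>2"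
    and tails: "(\<lambda>N. B N / (v N)\<^sup>2 * (\<Sum>k=1..N. LINT \<omega>|M N. (tail (T N) (X N k \<omega>))\<^sup>2)) \<longlonglongrightarrow> 0"
    and cubes: "(\<lambda>N. (B N)\<^sup>2 / v N ^ 3 * (\<Sum>k=1..N. LINT \<omega>|M N. \<bar>truncate (T N) (X N k \<omega>)\<bar> ^ 3)) \<longlonglongrightarrow> 0"
  shows "(\<lambda>N. CLINT \<omega>|M N. iexp (t * (((\<Sum>k=1..N. X N k \<omega>) - (LINT \<omega>|M N. (\<Sum>k=1..N. X N k \<omega>))) / v N)))
    \<longlonglongrightarrow> exp (- (t\<^sup>2 / 2))"
proof (subst LIM_zero_iff[symmetric], rule Lim_null_comparison)
  define L1 where "L1 N = B N / (v N)\<^sup>2 * (\<Sum>k=1..N. LINT \<omega>|M N. (tail (T N) (X N k \<omega>))\<^sup>2)" for N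
  define L2 where "L2 N = (B N)\<^sup>2 / v N ^ 3 * (\<Sum>k=1..N. LINT \<omega>|M N. \<bar>truncate (T N) (X N k \<omega>)\<bar> ^ 3)" for N
  \<comment> \<open>The summand \<open>inverse (Suc N)\<close> keeps \<open>\<rho> N\<close> positive where the tails vanish.\<close>
  define \<rho> where "\<rho> N = sqrt \<bar>L1 N\<bar> + inverse (real (Suc N))" for N
  have "L1 \<longlonglongrightarrow> 0" "L2 \<longlonglongrightarrow> 0" using tails cubes unfolding L1_def L2_def by auto
  note [tendsto_intros] = this LIMSEQ_inverse_real_of_nat
  have "\<rho> \<longlonglongrightarrow> sqrt \<bar>0\<bar> + 0" unfolding \<rho>_def by (intro tendsto_intros)
  then have [tendsto_intros]: "\<rho> \<longlonglongrightarrow> 0" by simp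
  have "(\<lambda>N. \<bar>t\<bar> * \<rho> N + t\<^sup>2 / 2 * (2 * \<rho> N + (\<rho> N)\<^sup>2) + 40 * \<bar>t\<bar> ^ 3 * L2 N)
     \<longlonglongrightarrow> \<bar>t\<bar> * 0 + t\<^sup>2 / 2 * (2 * 0 + 0\<^sup>2) + 40 * \<bar>t\<bar> ^ 3 * 0"
    by (intro tendsto_intros)
  then show "(\<lambda>N. \<bar>t\<bar> * \<rho> N + t\<^sup>2 / 2 * (2 * \<rho> N + (\<rho> N)\<^sup>2) + 40 * \<bar>t\<bar> ^ 3 * L2 N) \<longlonglongrightarrow> 0"
    by simp
  show "\<forall>\<^sub>F N in sequentially. cmod ((CLINT \<omega>|M N. iexp (t * (((\<Sum>k=1..N. X N k \<omega>)
       - (LINT \<omega>|M N. (\<Sum>k=1..N. X N k \<omega>))) / v N))) - complex_of_real (exp (- (t\<^sup>2 / 2))))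
     \<le> \<bar>t\<bar> * \<rho> N + t\<^sup>2 / 2 * (2 * \<rho> N + (\<rho> N)\<^sup>2) + 40 * \<bar>t\<bar> ^ 3 * L2 N"
    using v eventually_ge_at_top[of 1]
  proof eventually_elim
    case (elim N)
    interpret dependency_neighbourhoods "M N" "{1..N}" "nb N" "B N" "X N"
      using dep elim by simp
    have "L1 N \<le> \<bar>L1 N\<bar>" by simp
    also have "\<dots> = (sqrt \<bar>L1 N\<bar>)\<^sup>2" by simp
    also have "\<dots> \<le> (\<rho> N)\<^sup>2" unfolding \<rho>_def by (intro power_mono) auto
    finally have "L1 N \<le> (\<rho> N)\<^sup>2" .
    moreover have "0 < \<rho> N" unfolding \<rho>_def by (intro add_nonneg_pos) auto
    ultimately show ?case
      using elim sq by (intro normal_approximation[where T = "T N"]) (auto simp: L1_def L2_def)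
  qed
qed

section \<open>Triangular arrays\<close>

text \<open>
  These rewrite the two quantities in the moment conditions, with \<open>p = 1 / \<delta>\<close>, as the terms that
  bound the tails and the third moments. They also hold for \<open>A = 0\<close>, where both sides are \<open>0\<close>
  because of \<open>x / 0 = 0\<close> and \<open>0 powr p = 0\<close>.
\<close>
lemma inverse_xi_identities:
  fixes n A b v p :: real
  assumes "0 < n" "0 < b" "0 < v" "0 \<le> A"
  shows "1 / ((n / A) powr p * sqrt (v\<^sup>2 / (n * b))) * (b / n) powr (1/2 - p) = A powr p * b powr (1 - p) / v"
    and "1 / ((n / A) powr p * sqrt (v\<^sup>2 / (n * b))) ^ 3 * sqrt (b / n) = b\<^sup>2 / v ^ 3 * (n * (A / n) powr (p * 3))"
proof -
  define x y a sn sb where "x = n powr p" and "y = b powr p" and "a = A powr p" and "sn = sqrt n" and "sb = sqrt b"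
  have pos: "0 < x" "0 < y" "0 \<le> a" "0 < sn" "0 < sb" and sq: "n = sn\<^sup>2" "b = sb\<^sup>2"
    using assms by (auto simp: x_def y_def a_def sn_def sb_def)
  have 1: "(n / A) powr p = x / a" using assms by (simp add: powr_divide x_def a_def)
  have 2: "sqrt (v\<^sup>2 / (n * b)) = v / (sn * sb)"
    using assms by (simp add: real_sqrt_divide real_sqrt_mult sn_def sb_def)
  have 3: "(b / n) powr (1/2 - p) = (sb / y) / (sn / x)"
    using assms by (simp add: powr_divide powr_diff powr_half_sqrt x_def y_def sn_def sb_def)
  have 4: "b powr (1 - p) = sb\<^sup>2 / y"
    using assms by (simp add: powr_diff y_def sb_def)
  have 5: "(A / n) powr (p * 3) = (a / x) ^ 3"
    using assms by (simp add: powr_divide x_def a_def power_divide powr_powr[symmetric] powr_numeral)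
  have 6: "sqrt (b / n) = sb / sn" by (simp add: real_sqrt_divide sn_def sb_def)
  show "1 / ((n / A) powr p * sqrt (v\<^sup>2 / (n * b))) * (b / n) powr (1/2 - p) = A powr p * b powr (1 - p) / v"
    unfolding 1 2 3 4 a_def[symmetric] using pos \<open>0 < v\<close> by (simp add: field_simps power2_eq_square)
  show "1 / ((n / A) powr p * sqrt (v\<^sup>2 / (n * b))) ^ 3 * sqrt (b / n) = b\<^sup>2 / v ^ 3 * (n * (A / n) powr (p * 3))"
    unfolding 1 2 5 6 unfolding sq using pos \<open>0 < v\<close>
    by (simp add: field_simps power2_eq_square power3_eq_cube)
qed

text \<open>
  The level \<open>v / b\<close> is the one at which the tail bound (exponent 2) and the truncated third moment
  bound (exponent 3) coincide.
\<close>
lemma truncation_exponents: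
  fixes A b v \<delta> :: real
  assumes "0 < b" "0 < v" "0 \<le> A" "0 < \<delta>"
  shows "b / v\<^sup>2 * ((v / b) powr (2 - \<delta>) * A) = (A powr (1 / \<delta>) * b powr (1 - 1 / \<delta>) / v) powr \<delta>"
    and "b\<^sup>2 / v ^ 3 * ((v / b) powr (3 - \<delta>) * A) = (A powr (1 / \<delta>) * b powr (1 - 1 / \<delta>) / v) powr \<delta>"
proof -
  have e: "(1 - 1 / \<delta>) * \<delta> = \<delta> - 1" using assms by (simp add: field_simps)
  have r: "(A powr (1 / \<delta>) * b powr (1 - 1 / \<delta>) / v) powr \<delta> = A * (b powr \<delta> / b) / v powr \<delta>"
    using assms by (simp add: powr_mult powr_divide powr_powr e powr_diff)
  show "b / v\<^sup>2 * ((v / b) powr (2 - \<delta>) * A) = (A powr (1 / \<delta>) * b powr (1 - 1 / \<delta>) / v) powr \<delta>"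
    unfolding r using assms by (simp add: powr_divide powr_diff powr_numeral field_simps power2_eq_square)
  show "b\<^sup>2 / v ^ 3 * ((v / b) powr (3 - \<delta>) * A) = (A powr (1 / \<delta>) * b powr (1 - 1 / \<delta>) / v) powr \<delta>"
    unfolding r using assms
    by (simp add: powr_divide powr_diff powr_numeral field_simps power2_eq_square power3_eq_cube)
qed

lemma abs_diff_powr_le:
  fixes y c \<delta> :: real
  assumes "0 \<le> \<delta>"
  shows "\<bar>y - c\<bar> powr \<delta> \<le> 2 powr \<delta> * (\<bar>y\<bar> powr \<delta> + \<bar>c\<bar> powr \<delta>)"
proof -
  have "\<bar>y - c\<bar> powr \<delta> \<le> (2 * max \<bar>y\<bar> \<bar>c\<bar>) powr \<delta>"
    using assms by (intro powr_mono2) auto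
  also have "\<dots> = 2 powr \<delta> * max \<bar>y\<bar> \<bar>c\<bar> powr \<delta>"
    by (simp add: powr_mult)
  also have "\<dots> \<le> 2 powr \<delta> * (\<bar>y\<bar> powr \<delta> + \<bar>c\<bar> powr \<delta>)"
    by (intro mult_left_mono) (auto simp: max_def)
  finally show ?thesis .
qed

text \<open>
  The continuity theorem asks for a probability measure at every index, but row 0 of an array
  carries no assumption.
\<close>
lemma weak_conv_m_Suc:
  assumes "weak_conv_m (\<lambda>n. F (Suc n)) G"
  shows "weak_conv_m F G"
  using assms unfolding weak_conv_m_def weak_conv_def
  by (auto intro: LIMSEQ_imp_Suc)

text \<open>
  The letter \<open>b\<close> stands for the bound on the size of the neighbourhoods, and \<open>T\<close> is the truncation
  level, for which the tail and third moment estimates are of the same order.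
\<close>
locale triangular_array =
  fixes M :: "nat \<Rightarrow> 'a measure" and Y :: "nat \<Rightarrow> nat \<Rightarrow> 'a \<Rightarrow> real"
    and c :: "nat \<Rightarrow> nat \<Rightarrow> real" and D :: "nat \<Rightarrow> nat"
  assumes prob: "\<And>N. 1 \<le> N \<Longrightarrow> prob_space (M N)"
    and meas: "\<And>N k. 1 \<le> k \<Longrightarrow> k \<le> N \<Longrightarrow> Y N k \<in> borel_measurable (M N)"
    and sq_int: "\<And>N k. 1 \<le> k \<Longrightarrow> k \<le> N \<Longrightarrow> integrable (M N) (\<lambda>\<omega>. (Y N k \<omega>)\<^sup>2)"
    and dep: "\<And>N. 1 \<le> N \<Longrightarrow>
      \<exists>G. dependency_graph (M N) {1..N} (Y N) G \<and> max_mdegree {1..N} G = D N"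
    and var_pos: "\<forall>\<^sub>F N in sequentially. row_sd M Y N > 0"
begin

abbreviation X :: "nat \<Rightarrow> nat \<Rightarrow> 'a \<Rightarrow> real" where "X N k \<omega> \<equiv> Y N k \<omega> - c N k"
abbreviation b :: "nat \<Rightarrow> real" where "b N \<equiv> real (D N) + 1"
abbreviation v :: "nat \<Rightarrow> real" where "v \<equiv> row_sd M Y"
abbreviation A :: "real \<Rightarrow> nat \<Rightarrow> real" where "A \<delta> \<equiv> abs_moment_sum M Y c \<delta>"
abbreviation T :: "nat \<Rightarrow> real" where "T N \<equiv> v N / b N"

lemma integrable_Y:
  assumes "1 \<le> k" "k \<le> N"
  shows "integrable (M N) (Y N k)"
proof -
  interpret prob_space "M N" using prob assms by simp
  show ?thesis using square_integrable_imp_integrable[OF meas[OF assms] sq_int[OF assms]] .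
qed

lemma integrable_sq_X: "1 \<le> k \<Longrightarrow> k \<le> N \<Longrightarrow> integrable (M N) (\<lambda>\<omega>. (X N k \<omega>)\<^sup>2)"
proof -
  assume k: "1 \<le> k" "k \<le> N"
  interpret prob_space "M N" using prob k by simp
  show ?thesis unfolding power2_diff using integrable_Y[OF k] sq_int[OF k] by simp
qed

lemma measurable_X: "1 \<le> k \<Longrightarrow> k \<le> N \<Longrightarrow> X N k \<in> borel_measurable (M N)"
  using meas by simp

lemma sum_X: "(\<Sum>k=1..N. X N k \<omega>) = row_sum Y N \<omega> - (\<Sum>k=1..N. c N k)"
  by (simp add: row_sum_def sum_subtractf)

lemma integrable_row_sum: "integrable (M N) (row_sum Y N)"
  unfolding row_sum_def[abs_def] using integrable_Y by (intro Bochner_Integration.integrable_sum) auto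

lemma expectation_sum_X:
  assumes "1 \<le> N"
  shows "(LINT \<omega>|M N. (\<Sum>k=1..N. X N k \<omega>)) = row_mean M Y N - (\<Sum>k=1..N. c N k)"
proof -
  interpret prob_space "M N" using prob assms by simp
  show ?thesis unfolding sum_X row_mean_def using integrable_row_sum by (simp add: prob_space)
qed

lemma variance_sum_X:
  assumes "1 \<le> N" "0 < v N"
  shows "prob_space.variance (M N) (\<lambda>\<omega>. \<Sum>k=1..N. X N k \<omega>) = (v N)\<^sup>2"
proof -
  interpret prob_space "M N" using prob assms by simp
  have "0 < row_var M Y N" using assms by (simp add: row_sd_def)
  moreover have "prob_space.variance (M N) (\<lambda>\<omega>. \<Sum>k=1..N. X N k \<omega>) = row_var M Y N"
    unfolding expectation_sum_X[OF assms(1)] unfolding sum_X row_var_def row_mean_def by simp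
  ultimately show ?thesis by (simp add: row_sd_def)
qed

lemma row_standardized_eq:
  assumes "1 \<le> N"
  shows "row_standardized M Y N \<omega> = ((\<Sum>k=1..N. X N k \<omega>) - (LINT \<omega>|M N. (\<Sum>k=1..N. X N k \<omega>))) / v N"
  unfolding expectation_sum_X[OF assms] unfolding sum_X row_standardized_def by simp

lemma ex_dependency_neighbourhoods:
  assumes "1 \<le> N"
  shows "\<exists>nb. dependency_neighbourhoods (M N) {1..N} nb (b N) (X N)"
proof -
  obtain G where G: "dependency_graph (M N) {1..N} (Y N) G" "max_mdegree {1..N} G = D N"
    using dep[OF assms] by blast
  have "dependency_neighbourhoods (M N) {1..N} (\<lambda>k. {j \<in> {1..N}. j = k \<or> Upair k j \<in># G}) (b N) (Y N)"
    using dependency_graph_neighbourhoods[OF prob[OF assms] G(1)] meas G(2) by simp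
  from dependency_neighbourhoods.componentwise_transform[OF this, of "\<lambda>k x. x - c N k"] show ?thesis by auto
qed

lemma central_limit_theorem:
  assumes tails: "(\<lambda>N. b N / (v N)\<^sup>2 * (\<Sum>k=1..N. LINT \<omega>|M N. (tail (T N) (X N k \<omega>))\<^sup>2)) \<longlonglongrightarrow> 0"
    and cubes: "(\<lambda>N. (b N)\<^sup>2 / v N ^ 3 * (\<Sum>k=1..N. LINT \<omega>|M N. \<bar>truncate (T N) (X N k \<omega>)\<bar> ^ 3)) \<longlonglongrightarrow> 0"
  shows "weak_conv_m (\<lambda>N. distr (M N) borel (row_standardized M Y N)) std_normal_distribution"
proof (rule weak_conv_m_Suc, rule levy_continuity)
  have mW: "row_standardized M Y N \<in> borel_measurable (M N)" for N
  proof -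
    have [measurable]: "row_sum Y N \<in> borel_measurable (M N)"
      using integrable_row_sum by (rule borel_measurable_integrable)
    show ?thesis unfolding row_standardized_def[abs_def] by measurable
  qed
  show "real_distribution (distr (M (Suc N)) borel (row_standardized M Y (Suc N)))" for N
    by (rule prob_space.real_distribution_distr) (use prob mW in auto)
  show "real_distribution std_normal_distribution" by (rule real_dist_normal_dist)
  fix t :: real
  obtain nb where nb: "\<And>N. 1 \<le> N \<Longrightarrow> dependency_neighbourhoods (M N) {1..N} (nb N) (b N) (X N)"
    using ex_dependency_neighbourhoods by metis
  have "(\<lambda>N. CLINT \<omega>|M N. iexp (t * (((\<Sum>k=1..N. X N k \<omega>) - (LINT \<omega>|M N. (\<Sum>k=1..N. X N k \<omega>))) / v N)))
    \<longlonglongrightarrow> exp (- (t\<^sup>2 / 2))"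
  proof (rule char_fun_tendsto[OF nb integrable_sq_X _ tails cubes])
    show "\<forall>\<^sub>F N in sequentially. 0 < v N \<and> 0 \<le> T N \<and>
       prob_space.variance (M N) (\<lambda>\<omega>. \<Sum>k=1..N. X N k \<omega>) = (v N)\<^sup>2"
      using var_pos eventually_ge_at_top[of 1] by eventually_elim (intro conjI variance_sum_X; simp)
  qed
  from LIMSEQ_Suc[OF this]
  show "(\<lambda>N. char (distr (M (Suc N)) borel (row_standardized M Y (Suc N))) t) \<longlonglongrightarrow> char std_normal_distribution t"
    unfolding char_std_normal_distribution char_def
    by (simp add: integral_distr[OF mW] row_standardized_eq)
qed

lemma A_nonneg: "0 \<le> A \<delta> N"
  unfolding abs_moment_sum_def by (intro sum_nonneg Bochner_Integration.integral_nonneg) simp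

lemma integrable_powr_X:
  assumes "all_in_Lp M Y \<delta>" "0 \<le> \<delta>" "1 \<le> k" "k \<le> N"
  shows "integrable (M N) (\<lambda>\<omega>. \<bar>X N k \<omega>\<bar> powr \<delta>)"
proof (rule Bochner_Integration.integrable_bound)
  interpret prob_space "M N" using prob assms by simp
  show "integrable (M N) (\<lambda>\<omega>. 2 powr \<delta> * (\<bar>Y N k \<omega>\<bar> powr \<delta> + \<bar>c N k\<bar> powr \<delta>))"
    using assms unfolding all_in_Lp_def by simp
  show "(\<lambda>\<omega>. \<bar>X N k \<omega>\<bar> powr \<delta>) \<in> borel_measurable (M N)"
    using measurable_X[OF assms(3,4)] by measurable
  show "AE \<omega> in M N. norm (\<bar>X N k \<omega>\<bar> powr \<delta>) \<le> norm (2 powr \<delta> * (\<bar>Y N k \<omega>\<bar> powr \<delta> + \<bar>c N k\<bar> powr \<delta>))"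
    using abs_diff_powr_le[OF assms(2)] by (intro AE_I2) (auto simp: abs_mult)
qed

text \<open>
  Transfers the pointwise estimates of the truncated variables and of the tails to the sum of the
  \<open>\<delta>\<close>-th moments.
\<close>
lemma sum_expectation_le:
  assumes "all_in_Lp M Y \<delta>" "0 \<le> \<delta>"
    and "\<And>x. 0 \<le> f x" "\<And>x. f x \<le> K * \<bar>x\<bar> powr \<delta>" and [measurable]: "f \<in> borel_measurable borel"
  shows "(\<Sum>k=1..N. LINT \<omega>|M N. f (X N k \<omega>)) \<le> K * A \<delta> N"
proof -
  have "(LINT \<omega>|M N. f (X N k \<omega>)) \<le> K * (LINT \<omega>|M N. \<bar>X N k \<omega>\<bar> powr \<delta>)" if k: "k \<in> {1..N}" for k
  proof -
    have i: "integrable (M N) (\<lambda>\<omega>. K * \<bar>X N k \<omega>\<bar> powr \<delta>)"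
      using integrable_powr_X[OF assms(1,2), of k N] k by simp
    have "(LINT \<omega>|M N. f (X N k \<omega>)) \<le> (LINT \<omega>|M N. K * \<bar>X N k \<omega>\<bar> powr \<delta>)"
      using assms(4) order_trans[OF assms(3,4)] by (intro integral_mono' i)
    then show ?thesis by simp
  qed
  then show ?thesis unfolding abs_moment_sum_def sum_distrib_left by (rule sum_mono)
qed

text \<open>
  The quantity that the first moment condition sends to zero, free of the cancelling factors in \<open>xi\<close>.
\<close>
definition ratio :: "real \<Rightarrow> nat \<Rightarrow> real" where
  "ratio \<delta> N = A \<delta> N powr (1 / \<delta>) * b N powr (1 - 1 / \<delta>) / v N"

lemma eventually_ratio_eq:
  shows "\<forall>\<^sub>F N in sequentially. 1 / xi M Y c D \<delta> N * (b N / real N) powr (1/2 - 1/\<delta>) = ratio \<delta> N"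
    and "\<forall>\<^sub>F N in sequentially. 1 / xi M Y c D \<delta> N ^ 3 * sqrt (b N / real N)
      = (b N)\<^sup>2 / v N ^ 3 * (real N * (A \<delta> N / real N) powr (1 / \<delta> * 3))"
proof -
  have var: "row_var M Y N = (v N)\<^sup>2" if "0 < v N" for N
    using that by (simp add: row_sd_def)
  show "\<forall>\<^sub>F N in sequentially. 1 / xi M Y c D \<delta> N * (b N / real N) powr (1/2 - 1/\<delta>) = ratio \<delta> N"
    using var_pos eventually_ge_at_top[of 1]
    by eventually_elim (simp only: xi_def var ratio_def, rule inverse_xi_identities, auto simp: A_nonneg)
  show "\<forall>\<^sub>F N in sequentially. 1 / xi M Y c D \<delta> N ^ 3 * sqrt (b N / real N)
      = (b N)\<^sup>2 / v N ^ 3 * (real N * (A \<delta> N / real N) powr (1 / \<delta> * 3))"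
    using var_pos eventually_ge_at_top[of 1]
    by eventually_elim (simp only: xi_def var, rule inverse_xi_identities, auto simp: A_nonneg)
qed

lemma ratio_tendsto:
  assumes "cond_a M Y c D \<delta> \<or> cond_b M Y c D \<delta>"
  shows "ratio \<delta> \<longlonglongrightarrow> 0" and "2 < \<delta>" and "all_in_Lp M Y \<delta>"
  using assms tendsto_cong[OF eventually_ratio_eq(1)] unfolding cond_a_def cond_b_def by auto

lemma ratio_powr_tendsto:
  assumes "ratio \<delta> \<longlonglongrightarrow> 0" "2 < \<delta>"
  shows "(\<lambda>N. ratio \<delta> N powr \<delta>) \<longlonglongrightarrow> 0"
proof (rule tendsto_zero_powrI[OF assms(1) tendsto_const])
  show "\<forall>\<^sub>F N in sequentially. 0 \<le> ratio \<delta> N"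
    using var_pos by eventually_elim (simp add: ratio_def)
qed (use assms in simp)

lemma tails_tendsto_moment:
  assumes "ratio \<delta> \<longlonglongrightarrow> 0" "2 < \<delta>" "all_in_Lp M Y \<delta>"
  shows "(\<lambda>N. b N / (v N)\<^sup>2 * (\<Sum>k=1..N. LINT \<omega>|M N. (tail (T N) (X N k \<omega>))\<^sup>2)) \<longlonglongrightarrow> 0"
proof (rule Lim_null_comparison[OF _ ratio_powr_tendsto[OF assms(1,2)]])
  show "\<forall>\<^sub>F N in sequentially. norm (b N / (v N)\<^sup>2 * (\<Sum>k=1..N. LINT \<omega>|M N. (tail (T N) (X N k \<omega>))\<^sup>2))
      \<le> ratio \<delta> N powr \<delta>"
    using var_pos
  proof eventually_elim
    case (elim N)
    have "norm (b N / (v N)\<^sup>2 * (\<Sum>k=1..N. LINT \<omega>|M N. (tail (T N) (X N k \<omega>))\<^sup>2))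
        = b N / (v N)\<^sup>2 * (\<Sum>k=1..N. LINT \<omega>|M N. (tail (T N) (X N k \<omega>))\<^sup>2)"
      by (simp add: sum_nonneg)
    also have "\<dots> \<le> b N / (v N)\<^sup>2 * (T N powr (2 - \<delta>) * A \<delta> N)"
      using elim assms tail_square_le[of "T N" \<delta>]
      by (intro mult_left_mono sum_expectation_le[where f = "\<lambda>x. (tail (T N) x)\<^sup>2"]) auto
    also have "\<dots> = ratio \<delta> N powr \<delta>"
      unfolding ratio_def using elim A_nonneg assms(2) by (intro truncation_exponents(1)) auto
    finally show ?case .
  qed
qed

lemma cubes_tendsto_moment_less_3:
  assumes "ratio \<delta> \<longlonglongrightarrow> 0" "2 < \<delta>" "\<delta> < 3" "all_in_Lp M Y \<delta>"
  shows "(\<lambda>N. (b N)\<^sup>2 / v N ^ 3 * (\<Sum>k=1..N. LINT \<omega>|M N. \<bar>truncate (T N) (X N k \<omega>)\<bar> ^ 3)) \<longlonglongrightarrow> 0"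
proof (rule Lim_null_comparison[OF _ ratio_powr_tendsto[OF assms(1,2)]])
  show "\<forall>\<^sub>F N in sequentially. norm ((b N)\<^sup>2 / v N ^ 3 * (\<Sum>k=1..N. LINT \<omega>|M N. \<bar>truncate (T N) (X N k \<omega>)\<bar> ^ 3))
      \<le> ratio \<delta> N powr \<delta>"
    using var_pos
  proof eventually_elim
    case (elim N)
    have "norm ((b N)\<^sup>2 / v N ^ 3 * (\<Sum>k=1..N. LINT \<omega>|M N. \<bar>truncate (T N) (X N k \<omega>)\<bar> ^ 3))
        = (b N)\<^sup>2 / v N ^ 3 * (\<Sum>k=1..N. LINT \<omega>|M N. \<bar>truncate (T N) (X N k \<omega>)\<bar> ^ 3)"
      using elim by (simp add: sum_nonneg abs_mult)
    also have "\<dots> \<le> (b N)\<^sup>2 / v N ^ 3 * (T N powr (3 - \<delta>) * A \<delta> N)"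
      using elim assms truncate_cube_le[of "T N" \<delta>]
      by (intro mult_left_mono sum_expectation_le[where f = "\<lambda>x. \<bar>truncate (T N) x\<bar> ^ 3"]) auto
    also have "\<dots> = ratio \<delta> N powr \<delta>"
      unfolding ratio_def using elim A_nonneg assms(2) by (intro truncation_exponents(2)) auto
    finally show ?case .
  qed
qed

lemma cubes_tendsto_moment_ge_3:
  assumes "cond_b M Y c D \<delta>"
  shows "(\<lambda>N. (b N)\<^sup>2 / v N ^ 3 * (\<Sum>k=1..N. LINT \<omega>|M N. \<bar>truncate (T N) (X N k \<omega>)\<bar> ^ 3)) \<longlonglongrightarrow> 0"
proof (rule Lim_null_comparison)
  from assms have \<delta>: "3 \<le> \<delta>" and Lp: "all_in_Lp M Y \<delta>"
    and lim: "(\<lambda>N. 1 / xi M Y c D \<delta> N ^ 3 * sqrt (b N / real N)) \<longlonglongrightarrow> 0"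
    unfolding cond_b_def by auto
  show "(\<lambda>N. (b N)\<^sup>2 / v N ^ 3 * (real N * (A \<delta> N / real N) powr (1 / \<delta> * 3))) \<longlonglongrightarrow> 0"
    using lim tendsto_cong[OF eventually_ratio_eq(2)] by blast
  show "\<forall>\<^sub>F N in sequentially. norm ((b N)\<^sup>2 / v N ^ 3 * (\<Sum>k=1..N. LINT \<omega>|M N. \<bar>truncate (T N) (X N k \<omega>)\<bar> ^ 3))
      \<le> (b N)\<^sup>2 / v N ^ 3 * (real N * (A \<delta> N / real N) powr (1 / \<delta> * 3))"
    using var_pos eventually_ge_at_top[of 1]
  proof eventually_elim
    case (elim N)
    interpret prob_space "M N" using prob elim by simp
    have "(\<Sum>k=1..N. LINT \<omega>|M N. \<bar>truncate (T N) (X N k \<omega>)\<bar> ^ 3) \<le> real N * (A \<delta> N / real N) powr (1 / \<delta> * 3)"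
      using sum_third_moment_truncate_le[of "{1..N}" "X N" \<delta> "T N"] measurable_X integrable_powr_X[OF Lp] \<delta> elim
      by (simp add: abs_moment_sum_def)
    then show ?case using elim by (simp add: sum_nonneg abs_mult mult_left_mono divide_right_mono)
  qed
qed

lemma cond_c_bound:
  assumes "cond_c M Y c D"
  obtains C where "0 \<le> C" "\<And>N k. 1 \<le> k \<Longrightarrow> k \<le> N \<Longrightarrow> AE \<omega> in M N. \<bar>X N k \<omega>\<bar> \<le> C"
proof -
  let ?s = "SUP (N, k) \<in> {(N, k). 1 \<le> k \<and> k \<le> N}. Linf_norm (M N) (\<lambda>\<omega>. X N k \<omega>)"
  have "?s < \<infinity>" using assms unfolding cond_c_def by blast
  then obtain C0 where C0: "?s \<le> ereal C0" by (cases ?s) auto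
  show thesis
  proof (rule that[of "max 0 C0"])
    fix N k :: nat assume k: "1 \<le> k" "k \<le> N"
    have "Linf_norm (M N) (\<lambda>\<omega>. X N k \<omega>) \<le> ?s"
      using k by (intro SUP_upper2[of "(N, k)"]) auto
    with C0 have le: "esssup (M N) (\<lambda>\<omega>. ereal \<bar>X N k \<omega>\<bar>) \<le> ereal C0"
      unfolding Linf_norm_def by (rule order_trans[rotated])
    have "AE \<omega> in M N. ereal \<bar>X N k \<omega>\<bar> \<le> ereal C0"
      using esssup_AE[of "\<lambda>\<omega>. ereal \<bar>X N k \<omega>\<bar>" "M N"] by eventually_elim (rule order_trans[OF _ le])
    then show "AE \<omega> in M N. \<bar>X N k \<omega>\<bar> \<le> max 0 C0"
      by eventually_elim auto
  qed simp
qed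

text \<open>
  The level \<open>T\<close> tends to infinity, so it eventually exceeds the uniform bound and the tails vanish.
\<close>
lemma tails_tendsto_bounded:
  assumes "cond_c M Y c D"
  shows "(\<lambda>N. b N / (v N)\<^sup>2 * (\<Sum>k=1..N. LINT \<omega>|M N. (tail (T N) (X N k \<omega>))\<^sup>2)) \<longlonglongrightarrow> 0"
proof (rule tendsto_eventually)
  obtain C where C: "0 \<le> C" "\<And>N k. 1 \<le> k \<Longrightarrow> k \<le> N \<Longrightarrow> AE \<omega> in M N. \<bar>X N k \<omega>\<bar> \<le> C"
    using cond_c_bound[OF assms] by blast
  have "(\<lambda>N. b N / v N) \<longlonglongrightarrow> 0" using assms unfolding cond_c_def by blast
  then have "\<forall>\<^sub>F N in sequentially. b N / v N < 1 / (C + 1)"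
    by (rule order_tendstoD) (use C in auto)
  then show "\<forall>\<^sub>F N in sequentially. b N / (v N)\<^sup>2 * (\<Sum>k=1..N. LINT \<omega>|M N. (tail (T N) (X N k \<omega>))\<^sup>2) = 0"
    using var_pos
  proof eventually_elim
    case (elim N)
    then have "C \<le> T N" using C(1) by (simp add: field_simps)
    have "(LINT \<omega>|M N. (tail (T N) (X N k \<omega>))\<^sup>2) = 0" if "k \<in> {1..N}" for k
    proof (rule integral_eq_zero_AE)
      have "AE \<omega> in M N. \<bar>X N k \<omega>\<bar> \<le> C" using C(2) that by simp
      then show "AE \<omega> in M N. (tail (T N) (X N k \<omega>))\<^sup>2 = 0"
        by eventually_elim (use \<open>C \<le> T N\<close> in \<open>simp add: tail_def\<close>)
    qed
    then show ?case by simp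
  qed
qed

lemma cubes_tendsto_bounded:
  assumes "cond_c M Y c D"
  shows "(\<lambda>N. (b N)\<^sup>2 / v N ^ 3 * (\<Sum>k=1..N. LINT \<omega>|M N. \<bar>truncate (T N) (X N k \<omega>)\<bar> ^ 3)) \<longlonglongrightarrow> 0"
proof -
  obtain C where C: "0 \<le> C" "\<And>N k. 1 \<le> k \<Longrightarrow> k \<le> N \<Longrightarrow> AE \<omega> in M N. \<bar>X N k \<omega>\<bar> \<le> C"
    using cond_c_bound[OF assms] by blast
  have "(\<lambda>N. C ^ 3 * (real N * (b N)\<^sup>2 / v N ^ 3)) \<longlonglongrightarrow> C ^ 3 * 0"
    using assms unfolding cond_c_def by (intro tendsto_mult tendsto_const) blast
  then have lim: "(\<lambda>N. C ^ 3 * (real N * (b N)\<^sup>2 / v N ^ 3)) \<longlonglongrightarrow> 0" by simp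
  have "\<forall>\<^sub>F N in sequentially. norm ((b N)\<^sup>2 / v N ^ 3 * (\<Sum>k=1..N. LINT \<omega>|M N. \<bar>truncate (T N) (X N k \<omega>)\<bar> ^ 3))
      \<le> C ^ 3 * (real N * (b N)\<^sup>2 / v N ^ 3)"
    using var_pos eventually_ge_at_top[of 1]
  proof eventually_elim
    case (elim N)
    interpret prob_space "M N" using prob elim by simp
    have "(LINT \<omega>|M N. \<bar>truncate (T N) (X N k \<omega>)\<bar> ^ 3) \<le> C ^ 3" if k: "k \<in> {1..N}" for k
    proof -
      have "AE \<omega> in M N. \<bar>X N k \<omega>\<bar> \<le> C" using C(2) k by simp
      then have "AE \<omega> in M N. \<bar>truncate (T N) (X N k \<omega>)\<bar> ^ 3 \<le> C ^ 3"
        by eventually_elim (rule power_mono, use C(1) in \<open>auto simp: truncate_def\<close>)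
      moreover have "integrable (M N) (\<lambda>\<omega>. \<bar>truncate (T N) (X N k \<omega>)\<bar> ^ 3)"
        using measurable_X[of k N] k elim abs_truncate_le[of "T N"]
        by (intro integrable_bounded_rv bounded_rv_intros bounded_rvI[where K = "T N"]) auto
      ultimately have "(LINT \<omega>|M N. \<bar>truncate (T N) (X N k \<omega>)\<bar> ^ 3) \<le> (LINT \<omega>|M N. C ^ 3)"
        by (intro integral_mono_AE) auto
      then show ?thesis by (simp add: prob_space)
    qed
    then have "(\<Sum>k=1..N. LINT \<omega>|M N. \<bar>truncate (T N) (X N k \<omega>)\<bar> ^ 3) \<le> (\<Sum>k=1..N. C ^ 3)"
      by (rule sum_mono)
    then have "(b N)\<^sup>2 / v N ^ 3 * (\<Sum>k=1..N. LINT \<omega>|M N. \<bar>truncate (T N) (X N k \<omega>)\<bar> ^ 3)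
       \<le> (b N)\<^sup>2 / v N ^ 3 * (real N * C ^ 3)"
      using elim by (intro mult_left_mono) auto
    then show ?case using elim by (simp add: sum_nonneg abs_mult mult_ac)
  qed
  then show ?thesis by (rule Lim_null_comparison[OF _ lim])
qed

lemma row_standardized_tendsto:
  assumes "(\<exists>\<delta>. cond_a M Y c D \<delta> \<or> cond_b M Y c D \<delta>) \<or> cond_c M Y c D"
  shows "weak_conv_m (\<lambda>N. distr (M N) borel (row_standardized M Y N)) std_normal_distribution"
proof (cases "cond_c M Y c D")
  case True
  show ?thesis
    by (intro central_limit_theorem tails_tendsto_bounded cubes_tendsto_bounded True)
next
  case False
  then obtain \<delta> where \<delta>: "cond_a M Y c D \<delta> \<or> cond_b M Y c D \<delta>" using assms by blast
  note r = ratio_tendsto[OF \<delta>]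
  have "(\<lambda>N. (b N)\<^sup>2 / v N ^ 3 * (\<Sum>k=1..N. LINT \<omega>|M N. \<bar>truncate (T N) (X N k \<omega>)\<bar> ^ 3)) \<longlonglongrightarrow> 0"
    using \<delta> r cubes_tendsto_moment_less_3 cubes_tendsto_moment_ge_3 unfolding cond_a_def by blast
  with tails_tendsto_moment[OF r] show ?thesis by (rule central_limit_theorem)
qed

text \<open>
  Since \<open>b N \<ge> 1\<close>, the inverse standard deviation is dominated by \<open>b N / v N\<close> in the bounded case;
  in the other cases by a multiple of \<open>ratio \<delta> N\<close>, once the moment sum stays away from zero.
\<close>
lemma inverse_sd_tendsto:
  assumes "cond_c M Y c D \<or> (\<exists>\<delta>. liminf (\<lambda>N. ereal (A \<delta> N)) > 0 \<and>
                 (cond_a M Y c D \<delta> \<or> cond_b M Y c D \<delta>))"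
  shows "(\<lambda>N. 1 / v N) \<longlonglongrightarrow> 0"
proof (cases "cond_c M Y c D")
  case True
  show ?thesis
  proof (rule Lim_null_comparison)
    show "(\<lambda>N. b N / v N) \<longlonglongrightarrow> 0" using True unfolding cond_c_def by blast
    show "\<forall>\<^sub>F N in sequentially. norm (1 / v N) \<le> b N / v N"
      using var_pos by eventually_elim (simp add: divide_right_mono)
  qed
next
  case False
  then obtain \<delta> where \<delta>: "cond_a M Y c D \<delta> \<or> cond_b M Y c D \<delta>" and "liminf (\<lambda>N. ereal (A \<delta> N)) > 0"
    using assms by blast
  note r = ratio_tendsto[OF \<delta>]
  obtain a0 where a0: "0 < ereal a0" "ereal a0 < liminf (\<lambda>N. ereal (A \<delta> N))"
    using ereal_dense2[OF \<open>liminf _ > 0\<close>] by blast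
  show ?thesis
  proof (rule Lim_null_comparison)
    have "(\<lambda>N. ratio \<delta> N / a0 powr (1 / \<delta>)) \<longlonglongrightarrow> 0 / a0 powr (1 / \<delta>)"
      using r(1) a0 by (intro tendsto_intros) auto
    then show "(\<lambda>N. ratio \<delta> N / a0 powr (1 / \<delta>)) \<longlonglongrightarrow> 0" by simp
    show "\<forall>\<^sub>F N in sequentially. norm (1 / v N) \<le> ratio \<delta> N / a0 powr (1 / \<delta>)"
      using var_pos less_LiminfD[OF a0(2)]
    proof eventually_elim
      case (elim N)
      have "a0 powr (1 / \<delta>) * 1 \<le> A \<delta> N powr (1 / \<delta>) * b N powr (1 - 1 / \<delta>)"
        using elim a0 r(2) by (intro mult_mono powr_mono2 ge_one_powr_ge_zero) auto
      then have "a0 powr (1 / \<delta>) / v N \<le> ratio \<delta> N"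
        unfolding ratio_def using elim by (simp add: divide_right_mono)
      then show ?case using a0 elim by (simp add: field_simps)
    qed
  qed
qed

text \<open>
  Chebyshev's inequality: the quotient has variance \<open>1 / (v N)\<^sup>2\<close>.
\<close>
lemma centred_sum_div_variance_tendsto:
  assumes "(\<lambda>N. 1 / v N) \<longlonglongrightarrow> 0"
  shows "tends_to_zero_in_prob M (\<lambda>N \<omega>. (row_sum Y N \<omega> - row_mean M Y N) / row_var M Y N)"
  unfolding tends_to_zero_in_prob_def
proof (intro allI impI)
  fix \<epsilon> :: real assume \<epsilon>: "0 < \<epsilon>"
  show "(\<lambda>N. measure (M N) {\<omega> \<in> space (M N). \<bar>(row_sum Y N \<omega> - row_mean M Y N) / row_var M Y N\<bar> > \<epsilon>}) \<longlonglongrightarrow> 0"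
  proof (rule Lim_null_comparison)
    have "(\<lambda>N. (1 / v N)\<^sup>2 / \<epsilon>\<^sup>2) \<longlonglongrightarrow> 0\<^sup>2 / \<epsilon>\<^sup>2"
      using assms \<epsilon> by (intro tendsto_intros) auto
    then show "(\<lambda>N. (1 / v N)\<^sup>2 / \<epsilon>\<^sup>2) \<longlonglongrightarrow> 0" by simp
    show "\<forall>\<^sub>F N in sequentially. norm (measure (M N)
       {\<omega> \<in> space (M N). \<bar>(row_sum Y N \<omega> - row_mean M Y N) / row_var M Y N\<bar> > \<epsilon>}) \<le> (1 / v N)\<^sup>2 / \<epsilon>\<^sup>2"
      using var_pos eventually_ge_at_top[of 1]
    proof eventually_elim
      case (elim N)
      interpret prob_space "M N" using prob elim by simp
      have var: "row_var M Y N = (v N)\<^sup>2" using elim by (simp add: row_sd_def)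
      have [measurable]: "row_sum Y N \<in> borel_measurable (M N)"
        using integrable_row_sum by (rule borel_measurable_integrable)
      have pos: "0 < \<epsilon> * (v N)\<^sup>2" using \<epsilon> elim by simp
      have "integrable (M N) (\<lambda>\<omega>. (row_sum Y N \<omega> - row_mean M Y N)\<^sup>2)"
        using elim var not_integrable_integral_eq[of "M N"] unfolding row_var_def row_mean_def by fastforce
      then have "prob {\<omega> \<in> space (M N). \<epsilon> * (v N)\<^sup>2 \<le> \<bar>row_sum Y N \<omega> - row_mean M Y N\<bar>}
          \<le> expectation (\<lambda>\<omega>. (row_sum Y N \<omega> - row_mean M Y N)\<^sup>2) / (\<epsilon> * (v N)\<^sup>2)\<^sup>2"
        using pos by (intro second_moment_method) auto
      also have "\<dots> = (v N)\<^sup>2 / (\<epsilon> * (v N)\<^sup>2)\<^sup>2"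
        using var unfolding row_var_def row_mean_def by simp
      also have "\<dots> = (1 / v N)\<^sup>2 / \<epsilon>\<^sup>2"
        using elim by (simp add: field_simps power2_eq_square)
      finally have "prob {\<omega> \<in> space (M N). \<epsilon> * (v N)\<^sup>2 \<le> \<bar>row_sum Y N \<omega> - row_mean M Y N\<bar>} \<le> (1 / v N)\<^sup>2 / \<epsilon>\<^sup>2" .
      moreover have "prob {\<omega> \<in> space (M N). \<bar>(row_sum Y N \<omega> - row_mean M Y N) / row_var M Y N\<bar> > \<epsilon>}
          \<le> prob {\<omega> \<in> space (M N). \<epsilon> * (v N)\<^sup>2 \<le> \<bar>row_sum Y N \<omega> - row_mean M Y N\<bar>}"
        using elim by (intro finite_measure_mono) (auto simp: var abs_divide field_simps)
      ultimately show ?case by simp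
    qed
  qed
qed

end

theorem corollary5p1:
  fixes M :: "nat \<Rightarrow> 'a measure"
    and Y :: "nat \<Rightarrow> nat \<Rightarrow> 'a \<Rightarrow> real"
    and c :: "nat \<Rightarrow> nat \<Rightarrow> real"
    and D :: "nat \<Rightarrow> nat"
  assumes prob: "\<And>N. 1 \<le> N \<Longrightarrow> prob_space (M N)"
    and meas: "\<And>N k. 1 \<le> k \<Longrightarrow> k \<le> N \<Longrightarrow> Y N k \<in> borel_measurable (M N)"
    and sq_int: "\<And>N k. 1 \<le> k \<Longrightarrow> k \<le> N \<Longrightarrow> integrable (M N) (\<lambda>\<omega>. (Y N k \<omega>)\<^sup>2)"
    and dep: "\<And>N. 1 \<le> N \<Longrightarrow>
      \<exists>G. dependency_graph (M N) {1..N} (Y N) G \<and> max_mdegree {1..N} G = D N"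
    and var_pos: "\<forall>\<^sub>F N in sequentially. row_sd M Y N > 0"
  shows "((\<exists>\<delta>. cond_a M Y c D \<delta> \<or> cond_b M Y c D \<delta>) \<or> cond_c M Y c D \<longrightarrow>
            weak_conv_m (\<lambda>N. distr (M N) borel (row_standardized M Y N)) std_normal_distribution)
       \<and> (cond_c M Y c D \<or>
            (\<exists>\<delta>. liminf (\<lambda>N. ereal (abs_moment_sum M Y c \<delta> N)) > 0 \<and>
                 (cond_a M Y c D \<delta> \<or> cond_b M Y c D \<delta>)) \<longrightarrow>
            tends_to_zero_in_prob M
              (\<lambda>N \<omega>. (row_sum Y N \<omega> - row_mean M Y N) / row_var M Y N))"
proof -
  interpret triangular_array M Y c D
    by (rule triangular_array.intro) (fact assms)+
  show ?thesis
    using row_standardized_tendsto inverse_sd_tendsto centred_sum_div_variance_tendsto by blast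
qed

end
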